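(* For each integer $q\ge 3$ let $\bar{\bf x}^q=(1,2,\dots,q)'\in\mathbb{R}^q$ and $\bar{\bf y}^q=\bar{\bf x}^q-\frac{q+1}{2}{\bf e}^q=\left(-\frac{q-1}{2},-\frac{q-3}{2},\dots,\frac{q-3}{2},\frac{q-1}{2}\right)'$. The regular configurations $\{\bar{\bf x}^q\}$ and $\{\bar{\bf y}^q\}$ are asymptotically permutation-empty (APE).
   Context: Superscripts $q$ on vectors are indices. ${\bf e}^q=(1,\dots,1)'\in\mathbb{R}^q$; $\|\cdot\|$ is the Euclidean norm. $\widetilde{\mathcal M}^{q-1}=\{{\bf v}\in\mathbb{R}^q : {\bf v}'{\bf e}^q=0\}$, and $\widetilde{\mathcal M}^{q-1}_{\le}$ is the set of ${\bf v}\in\widetilde{\mathcal M}^{q-1}$ with $v_1\le\cdots\le v_q$. For ${\bf y}\in\mathbb{R}^q$, $\Pi({\bf y})=\{P{\bf y} : P \text{ a } q\times q \text{ permutation matrix}\}$. For $\rho>0$, $\widetilde{\mathcal S}^{q-2}_\rho=\{{\bf v}\in\widetilde{\mathcal M}^{q-1}:\|{\bf v}\|=\rho\}$, and $\widetilde{\bf U}^{q-2}_\rho$ is the uniform (normalized rotation-invariant) probability measure on $\widetilde{\mathcal S}^{q-2}_\rho$. A spherical cap in $\widetilde{\mathcal S}^{q-2}_\rho$ is a set $C({\bf w};t)=\{{\bf v}\in\widetilde{\mathcal S}^{q-2}_{\rho}:{\bf v}'{\bf w}>\rho^2t\}$ with ${\bf w}\in\widetilde{\mathcal S}^{q-2}_\rho$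 and $-1\le t<1$. A sequence of nonzero vectors $\{{\bf y}^q\in\widetilde{\mathcal M}^{q-1}_{\le}\}$ ($q$ varying) is APE if there exist $\epsilon>0$ and, for each $q$, a finite collection $\{C^q_i: i=1,\dots,n^q\}$ of (possibly overlapping) spherical caps in $\widetilde{\mathcal S}^{q-2}_{\|{\bf y}^q\|}$, each contained in $\widetilde{\mathcal S}^{q-2}_{\|{\bf y}^q\|}\setminus\Pi({\bf y}^q)$, such that $\widetilde{\bf U}^{q-2}_{\|{\bf y}^q\|}(C_i^q)\ge\epsilon$ for every $i$ and $q$, and $\lim_{q\to\infty}\widetilde{\bf U}^{q-2}_{\|{\bf y}^q\|}\left(\bigcup_{i=1}^{n^q}C_i^q\right)=1$. For a sequence ${\bf x}^q\in\mathbb{R}^q$ with ordered components $x^q_1\le\cdots\le x^q_q$ (not all equal), APE means the same property for its projections ${\bf x}^q-\left(\frac1q\sum_i x_i^q\right){\bf e}^q$ onto $\widetilde{\mathcal M}^{q-1}$. *)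

theory Defs
  imports "HOL-Probability.Probability"
begin

text \<open>
  Since the dimension \<open>q\<close> varies inside the statement, \<open>\<real>\<^sup>q\<close> is the set
  \<open>{1..q} \<rightarrow>\<^sub>E UNIV\<close> of extensional functions \<open>nat \<Rightarrow> real\<close>, which is also the space of the
  product \<open>\<sigma>\<close>-algebra \<open>\<Pi>\<^sub>M i\<in>{1..q}. borel\<close> (the Borel sets of \<open>\<real>\<^sup>q\<close>). Euclidean norm: \<open>L2_set\<close>.
  Matrices are functions of a row and a column index, read on \<open>{1..q} \<times> {1..q}\<close> only.
\<close>

definition Rvec :: "nat \<Rightarrow> (nat \<Rightarrow> real) set" where
  "Rvec q = {1..q} \<rightarrow>\<^sub>E UNIV"

definition dotp :: "nat \<Rightarrow> (nat \<Rightarrow> real) \<Rightarrow> (nat \<Rightarrow> real) \<Rightarrow> real" where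
  "dotp q v w = (\<Sum>i=1..q. v i * w i)"

definition mat_vec :: "nat \<Rightarrow> (nat \<Rightarrow> nat \<Rightarrow> real) \<Rightarrow> (nat \<Rightarrow> real) \<Rightarrow> (nat \<Rightarrow> real)" where
  "mat_vec q A v = (\<lambda>i\<in>{1..q}. \<Sum>j=1..q. A i j * v j)"

definition ones :: "nat \<Rightarrow> (nat \<Rightarrow> real)" where
  "ones q = (\<lambda>i\<in>{1..q}. 1)"

definition orthogonal_mat :: "nat \<Rightarrow> (nat \<Rightarrow> nat \<Rightarrow> real) \<Rightarrow> bool" where
  "orthogonal_mat q A \<longleftrightarrow>
     (\<forall>i\<in>{1..q}. \<forall>j\<in>{1..q}. (\<Sum>k=1..q. A k i * A k j) = (if i = j then 1 else 0))"

definition permutation_mat :: "nat \<Rightarrow> (nat \<Rightarrow> nat \<Rightarrow> real) \<Rightarrow> bool" where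
  "permutation_mat q P \<longleftrightarrow>
     (\<exists>\<sigma>. \<sigma> permutes {1..q} \<and>
        (\<forall>i\<in>{1..q}. \<forall>j\<in>{1..q}. P i j = (if j = \<sigma> i then 1 else 0)))"

definition perm_orbit :: "nat \<Rightarrow> (nat \<Rightarrow> real) \<Rightarrow> (nat \<Rightarrow> real) set" where
  "perm_orbit q y = {mat_vec q P y | P. permutation_mat q P}"

definition hyperplane :: "nat \<Rightarrow> (nat \<Rightarrow> real) set" where
  "hyperplane q = {v \<in> Rvec q. dotp q v (ones q) = 0}"

definition ordered_hyperplane :: "nat \<Rightarrow> (nat \<Rightarrow> real) set" where
  "ordered_hyperplane q = {v \<in> hyperplane q. mono_on {1..q} v}"

definition hsphere :: "nat \<Rightarrow> real \<Rightarrow> (nat \<Rightarrow> real) set" where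
  "hsphere q \<rho> = {v \<in> hyperplane q. L2_set v {1..q} = \<rho>}"

definition cap :: "nat \<Rightarrow> real \<Rightarrow> (nat \<Rightarrow> real) \<Rightarrow> real \<Rightarrow> (nat \<Rightarrow> real) set" where
  "cap q \<rho> w t = {v \<in> hsphere q \<rho>. dotp q v w > \<rho>\<^sup>2 * t}"

definition is_cap :: "nat \<Rightarrow> real \<Rightarrow> (nat \<Rightarrow> real) set \<Rightarrow> bool" where
  "is_cap q \<rho> C \<longleftrightarrow> (\<exists>w t. w \<in> hsphere q \<rho> \<and> -1 \<le> t \<and> t < 1 \<and> C = cap q \<rho> w t)"

text \<open>
  The uniform distribution on the sphere is the unique Borel probability measure invariant under
  the orthogonal group of the hyperplane. Every element of that group is the restriction of an
  orthogonal \<open>q \<times> q\<close> matrix that maps the hyperplane into itself, and conversely.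
  The group acts transitively on the sphere when \<open>q \<ge> 2\<close> and \<open>\<rho> > 0\<close>, so the measure exists
  and is unique there; it is used only for \<open>q \<ge> 3\<close> and the norm \<open>\<rho>\<close> of a nonzero vector.
\<close>

definition hyperplane_rotation :: "nat \<Rightarrow> (nat \<Rightarrow> nat \<Rightarrow> real) \<Rightarrow> bool" where
  "hyperplane_rotation q A \<longleftrightarrow>
     orthogonal_mat q A \<and> mat_vec q A ` hyperplane q \<subseteq> hyperplane q"

definition is_uniform_on_hsphere :: "nat \<Rightarrow> real \<Rightarrow> (nat \<Rightarrow> real) measure \<Rightarrow> bool" where
  "is_uniform_on_hsphere q \<rho> U \<longleftrightarrow>
     prob_space U \<and>
     sets U = sets (restrict_space (\<Pi>\<^sub>M i\<in>{1..q}. (borel :: real measure)) (hsphere q \<rho>)) \<and>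
     (\<forall>A. hyperplane_rotation q A \<longrightarrow> distr U U (mat_vec q A) = U)"

definition uniform_hsphere :: "nat \<Rightarrow> real \<Rightarrow> (nat \<Rightarrow> real) measure" where
  "uniform_hsphere q \<rho> = (THE U. is_uniform_on_hsphere q \<rho> U)"

text \<open>
  Sequences are indexed by \<open>q \<ge> 3\<close>; their values at \<open>q < 3\<close> play no role.
\<close>

definition centered_APE :: "(nat \<Rightarrow> nat \<Rightarrow> real) \<Rightarrow> bool" where
  "centered_APE y \<longleftrightarrow>
     (\<forall>q\<ge>3. y q \<in> ordered_hyperplane q \<and> y q \<noteq> (\<lambda>i\<in>{1..q}. 0)) \<and>
     (\<exists>\<epsilon>>0. \<exists>(n :: nat \<Rightarrow> nat) (C :: nat \<Rightarrow> nat \<Rightarrow> (nat \<Rightarrow> real) set).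
        (\<forall>q\<ge>3. 1 \<le> n q \<and>
           (\<forall>i\<in>{1..n q}.
              is_cap q (L2_set (y q) {1..q}) (C q i) \<and>
              C q i \<subseteq> hsphere q (L2_set (y q) {1..q}) - perm_orbit q (y q) \<and>
              measure (uniform_hsphere q (L2_set (y q) {1..q})) (C q i) \<ge> \<epsilon>)) \<and>
        (\<lambda>q. measure (uniform_hsphere q (L2_set (y q) {1..q})) (\<Union>i\<in>{1..n q}. C q i))
          \<longlonglongrightarrow> 1)"

definition project :: "nat \<Rightarrow> (nat \<Rightarrow> real) \<Rightarrow> (nat \<Rightarrow> real)" where
  "project q x = (\<lambda>i\<in>{1..q}. x i - (1 / real q) * (\<Sum>j=1..q. x j) * ones q i)"

definition APE :: "(nat \<Rightarrow> nat \<Rightarrow> real) \<Rightarrow> bool" where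
  "APE x \<longleftrightarrow>
     (\<forall>q\<ge>3. x q \<in> Rvec q \<and> mono_on {1..q} (x q) \<and>
        (\<exists>i\<in>{1..q}. \<exists>j\<in>{1..q}. x q i \<noteq> x q j)) \<and>
     centered_APE (\<lambda>q. project q (x q))"

definition regular_x :: "nat \<Rightarrow> nat \<Rightarrow> real" where
  "regular_x q = (\<lambda>i\<in>{1..q}. real i)"

definition regular_y :: "nat \<Rightarrow> nat \<Rightarrow> real" where
  "regular_y q = (\<lambda>i\<in>{1..q}. regular_x q i - (real q + 1) / 2 * ones q i)"

end

theory Submission
  imports Defs
begin

text \<open>
  The caps are \<open>C\<^sub>i = {v. v\<^sub>i > (q - 1)/2}\<close> for \<open>i = 1, \<dots>, q\<close>. They contain no permutation of
  \<open>y\<close>, whose largest component is \<open>(q - 1)/2\<close>. A uniform point of the sphere is obtained by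
  projecting a standard Gaussian vector \<open>g\<close> to the hyperplane and normalizing; then \<open>C\<^sub>i\<close> is
  roughly the event \<open>g\<^sub>i > \<surd>3\<close>. A lower bound for its probability, uniform in \<open>q\<close>, follows
  from the independence of \<open>g\<^sub>i\<close> and the other coordinates, whose squared norm is at most
  \<open>2 (q - 1)\<close> with probability at least \<open>1/2\<close> by Markov's inequality. Likewise \<open>|g|\<^sup>2 \<le> K q\<close>
  fails with probability at most \<open>1/K\<close>, and when it holds, a point outside all caps has all
  \<open>g\<^sub>i \<le> 3 \<surd>K\<close>, which is exponentially unlikely.

  That the uniform measure exists and is unique, and that Gaussian measure is invariant under
  orthogonal matrices, both rest on Christensen's theorem: two measures that give all balls of
  radius \<open>r\<close> the same mass \<open>h r\<close> are equal.
\<close>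

section \<open>Measures determined by the mass of balls\<close>

declare One_nat_def [simp del]

abbreviation PB :: "nat \<Rightarrow> (nat \<Rightarrow> real) measure" where
  "PB q \<equiv> \<Pi>\<^sub>M i\<in>{1..q}. (borel :: real measure)"

definition edist :: "nat \<Rightarrow> (nat \<Rightarrow> real) \<Rightarrow> (nat \<Rightarrow> real) \<Rightarrow> real" where
  "edist q x y = L2_set (\<lambda>i. x i - y i) {1..q}"

definition eball :: "nat \<Rightarrow> (nat \<Rightarrow> real) \<Rightarrow> real \<Rightarrow> (nat \<Rightarrow> real) set" where
  "eball q x r = {y \<in> Rvec q. edist q x y < r}"

lemma space_PB: "space (PB q) = Rvec q"
  by (simp add: space_PiM Rvec_def)

lemma edist_commute: "edist q x y = edist q y x"
  by (simp add: edist_def L2_set_def power2_commute)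

lemma edist_triangle: "edist q x z \<le> edist q x y + edist q y z"
  using L2_set_triangle_ineq[of "\<lambda>i. x i - y i" "\<lambda>i. y i - z i" "{1..q}"]
  by (simp add: edist_def)

lemma abs_diff_le_edist: "i \<in> {1..q} \<Longrightarrow> \<bar>x i - y i\<bar> \<le> edist q x y"
  unfolding edist_def
  using member_le_L2_set[of "{1..q}" i "\<lambda>i. \<bar>x i - y i\<bar>"] by (simp add: L2_set_def)

text \<open>The Euclidean norm is at most the sum of the absolute coordinates. Dividing by
  \<open>q + 1\<close> instead of \<open>q\<close> keeps the bound strict and also covers
  \<open>q = 0\<close>.\<close>

lemma edist_less_if_coords_close:
  assumes "\<And>i. i \<in> {1..q} \<Longrightarrow> \<bar>x i - y i\<bar> < r / (real q + 1)" "r > 0"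
  shows "edist q x y < r"
proof -
  have "edist q x y \<le> (\<Sum>i\<in>{1..q}. \<bar>x i - y i\<bar>)"
    unfolding edist_def by (rule L2_set_le_sum_abs)
  also have "\<dots> \<le> (\<Sum>i\<in>{1..q}. r / (real q + 1))"
    by (rule sum_mono) (use assms(1) less_imp_le in blast)
  also have "\<dots> = r * (real q / (real q + 1))" by simp
  also have "\<dots> < r * 1"
    by (rule mult_strict_left_mono) (use assms(2) in \<open>auto simp: field_simps\<close>)
  finally show ?thesis by simp
qed

lemma measurable_edist [measurable (raw)]:
  assumes [measurable]: "f \<in> M \<rightarrow>\<^sub>M PB q" "g \<in> M \<rightarrow>\<^sub>M PB q"
  shows "(\<lambda>w. edist q (f w) (g w)) \<in> borel_measurable M"
  unfolding edist_def L2_set_def by measurable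

lemma eball_sets: "x \<in> Rvec q \<Longrightarrow> eball q x r \<in> sets (PB q)"
proof -
  assume "x \<in> Rvec q"
  then have "(\<lambda>y. edist q x y) \<in> borel_measurable (PB q)"
    by (intro measurable_edist) (auto simp: space_PB)
  then have [measurable]: "edist q x \<in> borel_measurable (PB q)" by simp
  have "{y \<in> space (PB q). edist q x y < r} \<in> sets (PB q)" by measurable
  then show ?thesis by (simp add: eball_def space_PB)
qed

text \<open>Points with rational coordinates are dense. Such covers yield \<sigma>-finiteness and
  reduce null sets to small balls.\<close>

lemma countable_ball_cover:
  assumes "r > 0"
  obtains D where "countable D" "D \<subseteq> Rvec q" "(\<Union>p\<in>D. eball q p r) = Rvec q"
proof
  show "countable (PiE {1..q} (\<lambda>_. \<rat> :: real set))"
    by (intro countable_PiE countable_rat) auto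
  show "PiE {1..q} (\<lambda>_. \<rat> :: real set) \<subseteq> Rvec q" by (auto simp: Rvec_def)
  show "(\<Union>p\<in>PiE {1..q} (\<lambda>_. \<rat> :: real set). eball q p r) = Rvec q"
  proof (intro equalityI subsetI)
    fix x assume x: "x \<in> Rvec q"
    have "\<exists>s. s \<in> \<rat> \<and> \<bar>s - x i\<bar> < r / (real q + 1)" for i
    proof -
      have "x i - r / (real q + 1) < x i + r / (real q + 1)"
        using assms by (simp add: add_pos_nonneg)
      then obtain s where "s \<in> \<rat>" "x i - r / (real q + 1) < s" "s < x i + r / (real q + 1)"
        using Rats_dense_in_real by blast
      then show ?thesis by (intro exI[of _ s]) (simp add: abs_less_iff)
    qed
    then obtain s where s: "\<And>i. s i \<in> \<rat>" "\<And>i. \<bar>s i - x i\<bar> < r / (real q + 1)"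
      by metis
    have "edist q (restrict s {1..q}) x < r"
      by (rule edist_less_if_coords_close) (use s assms in auto)
    with x s(1) show "x \<in> (\<Union>p\<in>PiE {1..q} (\<lambda>_. \<rat> :: real set). eball q p r)"
      by (intro UN_I[of "restrict s {1..q}"]) (auto simp: eball_def)
  qed (auto simp: eball_def)
qed

text \<open>Openness for the Euclidean metric on \<open>Rvec q\<close>. Measurability is part of the
  definition, so these sets belong to the product \<sigma>-algebra by construction; that they
  generate it is shown below.\<close>

definition eopen :: "nat \<Rightarrow> (nat \<Rightarrow> real) set \<Rightarrow> bool" where
  "eopen q G \<longleftrightarrow> G \<in> sets (PB q) \<and> (\<forall>x\<in>G. \<exists>r>0. eball q x r \<subseteq> G)"

lemma eopen_eball: "x \<in> Rvec q \<Longrightarrow> eopen q (eball q x r)"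
  unfolding eopen_def
proof (intro conjI ballI eball_sets)
  fix y assume x: "x \<in> Rvec q" and y: "y \<in> eball q x r"
  have "eball q y (r - edist q x y) \<subseteq> eball q x r"
    by (auto simp: eball_def intro: le_less_trans[OF edist_triangle[of q x _ y]])
  with y show "\<exists>r'>0. eball q y r' \<subseteq> eball q x r"
    by (intro exI[of _ "r - edist q x y"]) (auto simp: eball_def)
qed

lemma Int_stable_eopen: "Int_stable (Collect (eopen q))"
proof (rule Int_stableI)
  fix A B assume "A \<in> Collect (eopen q)" "B \<in> Collect (eopen q)"
  then have AB: "eopen q A" "eopen q B" by auto
  show "A \<inter> B \<in> Collect (eopen q)"
    unfolding eopen_def mem_Collect_eq
  proof (intro conjI ballI)
    fix x assume "x \<in> A \<inter> B"
    then obtain r s where "r > 0" "eball q x r \<subseteq> A" "s > 0" "eball q x s \<subseteq> B"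
      using AB unfolding eopen_def by blast
    then show "\<exists>r>0. eball q x r \<subseteq> A \<inter> B"
      by (intro exI[of _ "min r s"]) (auto simp: eball_def)
  qed (use AB in \<open>auto simp: eopen_def\<close>)
qed

text \<open>The product \<sigma>-algebra is the smallest one that makes all coordinates measurable,
  and the preimage of an open set under a coordinate is \<open>eopen\<close>. Hence the identity is
  measurable from the generated \<sigma>-algebra into the product.\<close>

lemma sets_PB_eq_sigma_eopen: "sets (PB q) = sigma_sets (Rvec q) (Collect (eopen q))"
proof
  have sub: "Collect (eopen q) \<subseteq> Pow (Rvec q)"
    using sets.sets_into_space[of _ "PB q"] unfolding eopen_def space_PB by blast
  have "sigma_sets (space (PB q)) (Collect (eopen q)) \<subseteq> sets (PB q)"
    by (rule sets.sigma_sets_subset) (auto simp: eopen_def)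
  then show "sigma_sets (Rvec q) (Collect (eopen q)) \<subseteq> sets (PB q)"
    by (simp only: space_PB)
  have "(\<lambda>x. x) \<in> sigma (Rvec q) (Collect (eopen q)) \<rightarrow>\<^sub>M PB q"
  proof (rule measurable_PiM_single')
    fix i assume i: "i \<in> {1..q}"
    show "(\<lambda>x. x i) \<in> borel_measurable (sigma (Rvec q) (Collect (eopen q)))"
    proof (rule borel_measurableI)
      fix S :: "real set" assume S: "open S"
      have "eopen q ((\<lambda>x. x i) -` S \<inter> Rvec q)"
        unfolding eopen_def
      proof (intro conjI ballI)
        have "(\<lambda>x. x i) -` S \<inter> space (PB q) \<in> sets (PB q)"
          by (rule measurable_sets[OF measurable_component_singleton[OF i]]) (use S in auto)
        then show "(\<lambda>x. x i) -` S \<inter> Rvec q \<in> sets (PB q)" by (simp add: space_PB)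
        fix x assume "x \<in> (\<lambda>x. x i) -` S \<inter> Rvec q"
        with S obtain e where e: "e > 0" "\<And>y. dist y (x i) < e \<Longrightarrow> y \<in> S"
          by (auto simp: open_dist)
        have "eball q x e \<subseteq> (\<lambda>x. x i) -` S \<inter> Rvec q"
          by (auto simp: eball_def dist_real_def edist_commute[of q x]
              intro!: e(2) le_less_trans[OF abs_diff_le_edist[OF i, of _ x]])
        with e(1) show "\<exists>r>0. eball q x r \<subseteq> (\<lambda>x. x i) -` S \<inter> Rvec q" by blast
      qed
      then show "(\<lambda>x. x i) -` S \<inter> space (sigma (Rvec q) (Collect (eopen q)))
          \<in> sets (sigma (Rvec q) (Collect (eopen q)))"
        using sub by (auto simp: sets_measure_of space_measure_of_conv)
    qed
  qed (use sub in \<open>auto simp: space_measure_of_conv Rvec_def\<close>)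
  note id = this
  show "sets (PB q) \<subseteq> sigma_sets (Rvec q) (Collect (eopen q))"
  proof
    fix X assume X: "X \<in> sets (PB q)"
    then have "X \<subseteq> Rvec q" using sets.sets_into_space space_PB by blast
    moreover have "(\<lambda>x. x) -` X \<inter> Rvec q \<in> sigma_sets (Rvec q) (Collect (eopen q))"
      using measurable_sets[OF id X] sub by (simp add: sets_measure_of space_measure_of)
    ultimately show "X \<in> sigma_sets (Rvec q) (Collect (eopen q))"
      by (simp add: Int_absorb2)
  qed
qed

text \<open>A uniformly distributed measure on \<open>S\<close> in the sense of geometric measure
  theory. It lives on all of \<open>Rvec q\<close> and is concentrated on \<open>S\<close>, so one
  setting serves Lebesgue measure (\<open>S\<close> the whole space) and sphere measures. Only balls
  centred in \<open>S\<close> have a prescribed mass.\<close>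

locale ball_uniform =
  fixes q :: nat and S :: "(nat \<Rightarrow> real) set" and h :: "real \<Rightarrow> ennreal"
    and \<mu> :: "(nat \<Rightarrow> real) measure"
  assumes sets_eq: "sets \<mu> = sets (PB q)"
    and S_sub: "S \<subseteq> Rvec q"
    and AE_S: "AE x in \<mu>. x \<in> S"
    and ball: "x \<in> S \<Longrightarrow> r > 0 \<Longrightarrow> emeasure \<mu> (eball q x r) = h r"
    and finite_h: "r > 0 \<Longrightarrow> h r < \<infinity>"
begin

lemma space_eq: "space \<mu> = Rvec q"
  using sets_eq_imp_space_eq[OF sets_eq] by (simp add: space_PB)

text \<open>Centres of a countable cover need not lie in \<open>S\<close>. A ball that misses
  \<open>S\<close> is null, and one that meets \<open>S\<close> at \<open>x\<close> is contained in
  the ball of twice the radius about \<open>x\<close>.\<close>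

lemma emeasure_small_ball_le:
  assumes "p \<in> Rvec q" "r > 0"
  shows "emeasure \<mu> (eball q p (r / 2)) \<le> h r"
proof (cases "eball q p (r / 2) \<inter> S = {}")
  case True
  have "emeasure \<mu> (eball q p (r / 2)) \<le> emeasure \<mu> {}"
    using AE_S by (intro emeasure_mono_AE) (use True in auto)
  then show ?thesis by simp
next
  case False
  then obtain x where x: "x \<in> S" "edist q p x < r / 2" by (auto simp: eball_def)
  then have "eball q p (r / 2) \<subseteq> eball q x r"
    by (auto simp: eball_def edist_commute[of q p x]
        intro: le_less_trans[OF edist_triangle[of q x _ p]])
  then have "emeasure \<mu> (eball q p (r / 2)) \<le> emeasure \<mu> (eball q x r)"
    using eball_sets[of x q r] x S_sub by (intro emeasure_mono) (auto simp: sets_eq)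
  with ball[OF x(1) assms(2)] show ?thesis by simp
qed

lemma sigma_finite: "sigma_finite_measure \<mu>"
proof -
  obtain D where D: "countable D" "D \<subseteq> Rvec q" "(\<Union>p\<in>D. eball q p (1/2)) = Rvec q"
    by (rule countable_ball_cover[of "1/2" q]) auto
  show ?thesis
  proof (unfold_locales, intro exI conjI)
    show "countable ((\<lambda>p. eball q p (1/2)) ` D)" using D(1) by blast
    show "(\<lambda>p. eball q p (1/2)) ` D \<subseteq> sets \<mu>"
      using D(2) eball_sets by (auto simp: sets_eq)
    show "\<Union> ((\<lambda>p. eball q p (1/2)) ` D) = space \<mu>" using D(3) by (simp add: space_eq)
    show "\<forall>a\<in>(\<lambda>p. eball q p (1/2)) ` D. emeasure \<mu> a \<noteq> \<infinity>"
    proof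
      fix a assume "a \<in> (\<lambda>p. eball q p (1/2)) ` D"
      then have "emeasure \<mu> a \<le> h 1" using emeasure_small_ball_le[of _ 1] D(2) by auto
      then show "emeasure \<mu> a \<noteq> \<infinity>" using finite_h[of 1] by auto
    qed
  qed
qed

text \<open>The degenerate case: countably many null balls cover the space. Outside this case
  division by \<open>h r\<close> is legitimate.\<close>

lemma null_if_ball_null:
  assumes "r > 0" "h r = 0"
  shows "emeasure \<mu> X = 0"
proof -
  obtain D where D: "countable D" "D \<subseteq> Rvec q" "(\<Union>p\<in>D. eball q p (r/2)) = Rvec q"
    by (rule countable_ball_cover[of "r/2" q]) (use assms in auto)
  have "emeasure \<mu> (\<Union>p\<in>D. eball q p (r/2)) = 0"
    using emeasure_small_ball_le[of _ r] assms D(2) eball_sets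
    by (intro null_setsD1 null_sets_UN' D(1)) (auto simp: null_sets_def sets_eq subset_iff)
  then have "emeasure \<mu> (space \<mu>) = 0" using D(3) by (simp add: space_eq)
  then show ?thesis using emeasure_space[of \<mu> X] by simp
qed

end

text \<open>Fubini for the set of pairs with \<open>y\<close> in \<open>G\<close> and distance below
  \<open>r\<close>, a condition symmetric in the two points. The mass functions \<open>h\<close> and
  \<open>k\<close> may differ, which later allows two of them to be compared.\<close>

lemma nn_integral_ball_swap:
  assumes \<mu>: "ball_uniform q S h \<mu>" and \<nu>: "ball_uniform q S k \<nu>"
    and G: "G \<in> sets (PB q)" and r: "r > 0"
  shows "(\<integral>\<^sup>+x. emeasure \<nu> (G \<inter> eball q x r) \<partial>\<mu>) = h r * emeasure \<nu> G"
proof -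
  interpret mu: ball_uniform q S h \<mu> by fact
  interpret nu: ball_uniform q S k \<nu> by fact
  interpret pair_sigma_finite \<mu> \<nu>
    by (intro pair_sigma_finite.intro mu.sigma_finite nu.sigma_finite)
  note [measurable_cong] = mu.sets_eq nu.sets_eq
  note [measurable] = G
  let ?F = "\<lambda>x y. indicator G y * indicator {..<r} (edist q x y) :: ennreal"
  have "(\<integral>\<^sup>+x. emeasure \<nu> (G \<inter> eball q x r) \<partial>\<mu>) = (\<integral>\<^sup>+x. (\<integral>\<^sup>+y. ?F x y \<partial>\<nu>) \<partial>\<mu>)"
  proof (rule nn_integral_cong)
    fix x assume "x \<in> space \<mu>"
    then have x: "x \<in> Rvec q" by (simp add: mu.space_eq)
    have "(\<integral>\<^sup>+y. ?F x y \<partial>\<nu>) = (\<integral>\<^sup>+y. indicator (G \<inter> eball q x r) y \<partial>\<nu>)"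
      by (rule nn_integral_cong) (auto simp: nu.space_eq eball_def indicator_def)
    then show "emeasure \<nu> (G \<inter> eball q x r) = (\<integral>\<^sup>+y. ?F x y \<partial>\<nu>)"
      using eball_sets[OF x, of r] G by (simp add: nn_integral_indicator nu.sets_eq)
  qed
  also have "\<dots> = (\<integral>\<^sup>+y. (\<integral>\<^sup>+x. ?F x y \<partial>\<mu>) \<partial>\<nu>)"
    by (rule Fubini'[symmetric]) measurable
  also have "\<dots> = (\<integral>\<^sup>+y. h r * indicator G y \<partial>\<nu>)"
  proof (rule nn_integral_cong_AE, use nu.AE_S in eventually_elim)
    fix y assume y: "y \<in> S"
    then have yR: "y \<in> Rvec q" using nu.S_sub by auto
    have "(\<integral>\<^sup>+x. ?F x y \<partial>\<mu>) = (\<integral>\<^sup>+x. indicator G y * indicator (eball q y r) x \<partial>\<mu>)"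
      by (rule nn_integral_cong)
        (auto simp: mu.space_eq eball_def indicator_def edist_commute[of q y])
    also have "\<dots> = indicator G y * emeasure \<mu> (eball q y r)"
      using eball_sets[OF yR, of r] by (simp add: nn_integral_cmult_indicator mu.sets_eq)
    finally show "(\<integral>\<^sup>+x. ?F x y \<partial>\<mu>) = h r * indicator G y"
      using mu.ball[OF y r] by (simp add: mult.commute)
  qed
  also have "\<dots> = h r * emeasure \<nu> G"
    using G by (simp add: nn_integral_cmult_indicator nu.sets_eq)
  finally show ?thesis .
qed

text \<open>
  Christensen's argument: for open \<open>G\<close>, almost every \<open>x \<in> G\<close> satisfies
  \<open>\<nu> (G \<inter> B(x,r)) / h r = 1\<close> for small \<open>r\<close>; integrate over \<open>\<mu>\<close> and use Fatou's lemma.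
\<close>

lemma ball_uniform_le:
  assumes \<mu>: "ball_uniform q S h \<mu>" and \<nu>: "ball_uniform q S h \<nu>" and G: "eopen q G"
  shows "emeasure \<mu> G \<le> emeasure \<nu> G"
proof (cases "\<exists>r>0. h r = 0")
  case True
  then show ?thesis using ball_uniform.null_if_ball_null[OF \<mu>] by force
next
  case False
  interpret mu: ball_uniform q S h \<mu> by fact
  interpret nu: ball_uniform q S h \<nu> by fact
  interpret sn: sigma_finite_measure \<nu> by (rule nu.sigma_finite)
  note [measurable_cong] = mu.sets_eq nu.sets_eq
  have Gs[measurable]: "G \<in> sets (PB q)" using G by (simp add: eopen_def)
  let ?r = "\<lambda>n. inverse (real (Suc n))"
  \<comment> \<open>Division in \<open>ennreal\<close> cancels only for values other than 0 and
    infinity.\<close>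
  have h: "h (?r n) \<noteq> 0" "h (?r n) \<noteq> \<infinity>" for n
    using False nu.finite_h[of "?r n"] by auto
  have meas[measurable]: "(\<lambda>x. emeasure \<nu> (G \<inter> eball q x r)) \<in> borel_measurable \<mu>" for r
  proof -
    have "(\<lambda>x. \<integral>\<^sup>+y. indicator G y * indicator {..<r} (edist q x y) \<partial>\<nu>) \<in> borel_measurable \<mu>"
      by measurable
    moreover have "(\<integral>\<^sup>+y. indicator G y * indicator {..<r} (edist q x y) \<partial>\<nu>)
        = emeasure \<nu> (G \<inter> eball q x r)" if "x \<in> space \<mu>" for x
    proof -
      have "(\<integral>\<^sup>+y. indicator G y * indicator {..<r} (edist q x y) \<partial>\<nu>)
          = (\<integral>\<^sup>+y. indicator (G \<inter> eball q x r) y \<partial>\<nu>)"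
        by (rule nn_integral_cong) (auto simp: nu.space_eq eball_def indicator_def)
      then show ?thesis using eball_sets[of x q r] Gs that
        by (simp add: nn_integral_indicator nu.sets_eq mu.space_eq)
    qed
    ultimately show ?thesis by (simp cong: measurable_cong)
  qed
  let ?f = "\<lambda>n x. emeasure \<nu> (G \<inter> eball q x (?r n)) / h (?r n)"
  have "emeasure \<mu> G = (\<integral>\<^sup>+x. indicator G x \<partial>\<mu>)"
    using Gs by (simp add: mu.sets_eq)
  also have "\<dots> \<le> (\<integral>\<^sup>+x. liminf (\<lambda>n. ?f n x) \<partial>\<mu>)"
  proof (rule nn_integral_mono_AE, use mu.AE_S in eventually_elim)
    fix x assume x: "x \<in> S"
    show "indicator G x \<le> liminf (\<lambda>n. ?f n x)"
    proof (cases "x \<in> G")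
      case True
      then obtain r where r: "r > 0" "eball q x r \<subseteq> G" using G by (auto simp: eopen_def)
      have "eventually (\<lambda>n. ?r n < r) sequentially"
        by (rule order_tendstoD(2)[OF LIMSEQ_inverse_real_of_nat r(1)])
      then have "eventually (\<lambda>n. 1 \<le> ?f n x) sequentially"
      proof eventually_elim
        case (elim n)
        then have "eball q x (?r n) \<subseteq> G" using r(2) by (force simp: eball_def)
        then have "G \<inter> eball q x (?r n) = eball q x (?r n)" by auto
        then have "?f n x = h (?r n) / h (?r n)" using nu.ball[OF x, of "?r n"] by simp
        also have "\<dots> = 1" using h[of n] by (intro ennreal_divide_self) (auto simp: less_top)
        finally show ?case by simp
      qed
      then have "1 \<le> liminf (\<lambda>n. ?f n x)" by (rule Liminf_bounded)
      then show ?thesis using True by simp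
    qed simp
  qed
  also have "\<dots> \<le> liminf (\<lambda>n. \<integral>\<^sup>+x. ?f n x \<partial>\<mu>)"
    by (rule nn_integral_liminf) measurable
  \<comment> \<open>By the Fubini swap these integrals do not depend on the radius, so the limit
    inferior is that of a constant sequence.\<close>
  also have "(\<lambda>n. \<integral>\<^sup>+x. ?f n x \<partial>\<mu>) = (\<lambda>n. emeasure \<nu> G)"
  proof
    fix n
    have "(\<integral>\<^sup>+x. ?f n x \<partial>\<mu>) = (\<integral>\<^sup>+x. emeasure \<nu> (G \<inter> eball q x (?r n)) \<partial>\<mu>) / h (?r n)"
      by (rule nn_integral_divide) measurable
    also have "\<dots> = h (?r n) * emeasure \<nu> G / h (?r n)"
      using nn_integral_ball_swap[OF \<mu> \<nu> Gs, of "?r n"] by simp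
    also have "\<dots> = emeasure \<nu> G"
      using h[of n] by (simp add: ennreal_mult_divide_eq mult.commute)
    finally show "(\<integral>\<^sup>+x. ?f n x \<partial>\<mu>) = emeasure \<nu> G" .
  qed
  also have "liminf (\<lambda>n. emeasure \<nu> G) = emeasure \<nu> G"
    by (simp add: Liminf_const)
  finally show ?thesis .
qed

text \<open>The hypotheses are symmetric in the two measures, so the inequality on open sets is an
  equality. Open sets form an intersection-stable generator, and countably many balls of finite mass
  cover the space.\<close>

lemma ball_uniform_unique:
  assumes \<mu>: "ball_uniform q S h \<mu>" and \<nu>: "ball_uniform q S h \<nu>"
  shows "\<mu> = \<nu>"
proof -
  interpret mu: ball_uniform q S h \<mu> by fact
  interpret nu: ball_uniform q S h \<nu> by fact
  obtain D where D: "countable D" "D \<subseteq> Rvec q" "(\<Union>p\<in>D. eball q p (1/2)) = Rvec q"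
    by (rule countable_ball_cover[of "1/2" q]) auto
  show ?thesis
  proof (rule measure_eqI_generator_eq_countable[OF Int_stable_eopen])
    show "Collect (eopen q) \<subseteq> Pow (Rvec q)"
      using sets.sets_into_space[of _ "PB q"] unfolding eopen_def space_PB by blast
    show "emeasure \<mu> X = emeasure \<nu> X" if "X \<in> Collect (eopen q)" for X
      using that by (intro antisym ball_uniform_le[OF \<mu> \<nu>] ball_uniform_le[OF \<nu> \<mu>]) auto
    show "sets \<mu> = sigma_sets (Rvec q) (Collect (eopen q))"
      "sets \<nu> = sigma_sets (Rvec q) (Collect (eopen q))"
      by (simp_all only: mu.sets_eq nu.sets_eq sets_PB_eq_sigma_eopen)
    show "(\<lambda>p. eball q p (1/2)) ` D \<subseteq> Collect (eopen q)" using D(2) eopen_eball by auto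
    show "\<Union> ((\<lambda>p. eball q p (1/2)) ` D) = Rvec q" using D(3) by simp
    show "countable ((\<lambda>p. eball q p (1/2)) ` D)" using D(1) by blast
    show "emeasure \<mu> a \<noteq> \<infinity>" if "a \<in> (\<lambda>p. eball q p (1/2)) ` D" for a
    proof -
      have "emeasure \<mu> a \<le> h 1" using that mu.emeasure_small_ball_le[of _ 1] D(2) by auto
      then show ?thesis using mu.finite_h[of 1] by auto
    qed
  qed
qed

section \<open>Orthogonal invariance of Gaussian measure\<close>

lemma mat_vec_apply: "i \<in> {1..q} \<Longrightarrow> mat_vec q A v i = (\<Sum>j=1..q. A i j * v j)"
  by (simp add: mat_vec_def)

lemma mat_vec_in_Rvec [simp]: "mat_vec q A v \<in> Rvec q"
  by (simp add: mat_vec_def Rvec_def)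

lemma measurable_mat_vec [measurable]: "mat_vec q A \<in> PB q \<rightarrow>\<^sub>M PB q"
  unfolding mat_vec_def by measurable

lemma Rvec_eqI: "x \<in> Rvec q \<Longrightarrow> y \<in> Rvec q \<Longrightarrow> (\<And>i. i \<in> {1..q} \<Longrightarrow> x i = y i) \<Longrightarrow> x = y"
  unfolding Rvec_def by (rule PiE_ext)

lemma L2_set_eq_dotp: "L2_set v {1..q} = sqrt (dotp q v v)"
  by (simp add: L2_set_def dotp_def power2_eq_square)

lemma dotp_mat_vec: "dotp q (mat_vec q A v) w = dotp q v (mat_vec q (\<lambda>i j. A j i) w)"
proof -
  have "dotp q (mat_vec q A v) w = (\<Sum>i=1..q. \<Sum>j=1..q. A i j * v j * w i)"
    by (simp add: dotp_def mat_vec_apply sum_distrib_right)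
  also have "\<dots> = (\<Sum>j=1..q. \<Sum>i=1..q. A i j * v j * w i)" by (rule sum.swap)
  also have "\<dots> = dotp q v (mat_vec q (\<lambda>i j. A j i) w)"
    by (simp add: dotp_def mat_vec_apply sum_distrib_left mult_ac)
  finally show ?thesis .
qed

lemma mat_vec_mat_vec_eq_self:
  assumes AB: "\<And>i j. i \<in> {1..q} \<Longrightarrow> j \<in> {1..q} \<Longrightarrow>
      (\<Sum>k=1..q. A i k * B k j) = (if i = j then 1 else 0)"
    and v: "v \<in> Rvec q"
  shows "mat_vec q A (mat_vec q B v) = v"
proof (rule Rvec_eqI[OF _ v])
  fix i assume i: "i \<in> {1..q}"
  have "mat_vec q A (mat_vec q B v) i = (\<Sum>k=1..q. \<Sum>j=1..q. A i k * B k j * v j)"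
    using i by (simp add: mat_vec_apply sum_distrib_left mult_ac)
  also have "\<dots> = (\<Sum>j=1..q. \<Sum>k=1..q. A i k * B k j * v j)" by (rule sum.swap)
  also have "\<dots> = (\<Sum>j=1..q. (\<Sum>k=1..q. A i k * B k j) * v j)"
    by (simp add: sum_distrib_right)
  also have "\<dots> = (\<Sum>j=1..q. (if i = j then v j else 0))"
    by (rule sum.cong) (use i AB in auto)
  also have "\<dots> = v i" using i by simp
  finally show "mat_vec q A (mat_vec q B v) i = v i" .
qed simp

text \<open>
  The matrix \<open>I - A A\<^sup>T\<close> is symmetric and idempotent with trace \<open>q - q\<close>, so its Frobenius norm
  vanishes.
\<close>

lemma orthogonal_rows:
  assumes A: "orthogonal_mat q A" and i: "i \<in> {1..q}" and j: "j \<in> {1..q}"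
  shows "(\<Sum>k=1..q. A i k * A j k) = (if i = j then 1 else 0)"
proof -
  define P where "P i j = (\<Sum>k=1..q. A i k * A j k)" for i j
  define \<delta> where "\<delta> i j = (if i = j then 1 else 0 :: real)" for i j :: nat
  have cols: "(\<Sum>i=1..q. A i k * A i l) = \<delta> k l" if "k \<in> {1..q}" "l \<in> {1..q}" for k l
    using A that by (simp add: orthogonal_mat_def \<delta>_def)
  have tr: "(\<Sum>i=1..q. P i i) = q"
  proof -
    have "(\<Sum>i=1..q. P i i) = (\<Sum>k=1..q. \<Sum>i=1..q. A i k * A i k)"
      unfolding P_def by (rule sum.swap)
    also have "\<dots> = (\<Sum>k=1..q. 1)"
      by (rule sum.cong[OF refl]) (simp add: cols \<delta>_def)
    finally show ?thesis by simp
  qed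
  \<comment> \<open>The squared Frobenius norm of \<open>P\<close>, the product of \<open>A\<close>
    and its transpose. Moving the sum over \<open>j\<close> innermost exposes the column relations,
    and what remains is the trace.\<close>
  have sq: "(\<Sum>i=1..q. \<Sum>j=1..q. (P i j)\<^sup>2) = q"
  proof -
    have "(\<Sum>i=1..q. \<Sum>j=1..q. (P i j)\<^sup>2)
        = (\<Sum>i=1..q. \<Sum>j=1..q. \<Sum>k=1..q. \<Sum>l=1..q. (A i k * A i l) * (A j k * A j l))"
      by (simp add: P_def power2_eq_square sum_product mult_ac)
    also have "\<dots> = (\<Sum>i=1..q. \<Sum>k=1..q. \<Sum>j=1..q. \<Sum>l=1..q. (A i k * A i l) * (A j k * A j l))"
      by (intro sum.cong refl sum.swap)
    also have "\<dots> = (\<Sum>i=1..q. \<Sum>k=1..q. \<Sum>l=1..q. \<Sum>j=1..q. (A i k * A i l) * (A j k * A j l))"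
      by (intro sum.cong refl sum.swap)
    also have "\<dots> = (\<Sum>i=1..q. \<Sum>k=1..q. \<Sum>l=1..q. (A i k * A i l) * \<delta> k l)"
      by (intro sum.cong refl) (simp add: cols flip: sum_distrib_left)
    also have "\<dots> = (\<Sum>i=1..q. P i i)"
      unfolding \<delta>_def P_def by (intro sum.cong refl) (simp add: if_distrib cong: if_cong)
    finally show ?thesis using tr by simp
  qed
  \<comment> \<open>Expanding the square gives \<open>q - 2 q + q = 0\<close>.\<close>
  have "(\<Sum>i=1..q. \<Sum>j=1..q. (P i j - \<delta> i j)\<^sup>2)
      = (\<Sum>i=1..q. \<Sum>j=1..q. (P i j)\<^sup>2) - 2 * (\<Sum>i=1..q. \<Sum>j=1..q. P i j * \<delta> i j)
        + (\<Sum>i=1..q. \<Sum>j=1..q. (\<delta> i j)\<^sup>2)"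
    by (simp add: power2_diff sum.distrib sum_subtractf sum_distrib_left mult_ac)
  also have "(\<Sum>i=1..q. \<Sum>j=1..q. P i j * \<delta> i j) = (\<Sum>i=1..q. P i i)"
    unfolding \<delta>_def by (intro sum.cong refl) (simp add: if_distrib cong: if_cong)
  also have "(\<Sum>i=1..q. \<Sum>j=1..q. (\<delta> i j)\<^sup>2) = (\<Sum>i=1..q. 1 :: real)"
    unfolding \<delta>_def by (intro sum.cong refl) (simp add: if_distrib[of "\<lambda>t. t\<^sup>2"] cong: if_cong)
  finally have "(\<Sum>i=1..q. \<Sum>j=1..q. (P i j - \<delta> i j)\<^sup>2) = 0"
    using tr sq by simp
  then have "(\<Sum>j=1..q. (P i j - \<delta> i j)\<^sup>2) = 0"
    using i by (subst (asm) sum_nonneg_eq_0_iff) (auto intro!: sum_nonneg)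
  then have "(P i j - \<delta> i j)\<^sup>2 = 0"
    using j by (subst (asm) sum_nonneg_eq_0_iff) auto
  then show ?thesis by (simp add: P_def \<delta>_def)
qed

context
  fixes q :: nat and A :: "nat \<Rightarrow> nat \<Rightarrow> real"
  assumes A: "orthogonal_mat q A"
begin

lemma orthogonal_transpose_left: "v \<in> Rvec q \<Longrightarrow> mat_vec q (\<lambda>i j. A j i) (mat_vec q A v) = v"
  using A by (intro mat_vec_mat_vec_eq_self) (auto simp: orthogonal_mat_def)

lemma orthogonal_transpose_right: "v \<in> Rvec q \<Longrightarrow> mat_vec q A (mat_vec q (\<lambda>i j. A j i) v) = v"
  by (intro mat_vec_mat_vec_eq_self) (auto simp: orthogonal_rows[OF A])

lemma dotp_orthogonal:
  assumes "w \<in> Rvec q"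
  shows "dotp q (mat_vec q A v) (mat_vec q A w) = dotp q v w"
  using orthogonal_transpose_left[OF assms] by (simp add: dotp_mat_vec)

lemma edist_orthogonal: "edist q (mat_vec q A x) (mat_vec q A y) = edist q x y"
proof -
  define d where "d = (\<lambda>i\<in>{1..q}. x i - y i)"
  have "edist q (mat_vec q A x) (mat_vec q A y) = L2_set (mat_vec q A d) {1..q}"
    unfolding edist_def
    by (rule L2_set_cong) (auto simp: mat_vec_apply d_def right_diff_distrib sum_subtractf)
  also have "\<dots> = L2_set d {1..q}"
    by (simp add: L2_set_eq_dotp dotp_orthogonal d_def Rvec_def)
  also have "\<dots> = edist q x y"
    unfolding edist_def by (rule L2_set_cong) (auto simp: d_def)
  finally show ?thesis .
qed

end

section \<open>Lebesgue measure: invariance under translations and orthogonal matrices\<close>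

abbreviation lebesgue_R :: "nat \<Rightarrow> (nat \<Rightarrow> real) measure" where
  "lebesgue_R q \<equiv> \<Pi>\<^sub>M i\<in>{1..q}. (lborel :: real measure)"

lemma sets_lebesgue_R [measurable_cong]: "sets (lebesgue_R q) = sets (PB q)"
  by (intro sets_PiM_cong) auto

lemma space_lebesgue_R: "space (lebesgue_R q) = Rvec q"
  by (simp add: space_PiM Rvec_def)

interpretation lborel_prod: product_sigma_finite "\<lambda>_::nat. lborel :: real measure"
  by standard

text \<open>A product measure is determined by boxes, and on a box the claim reduces to translation
  invariance in each coordinate.\<close>

lemma lebesgue_R_translation:
  "distr (lebesgue_R q) (PB q) (\<lambda>x. \<lambda>i\<in>{1..q}. c i + x i) = lebesgue_R q"
proof (rule lborel_prod.PiM_eqI)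
  fix A :: "nat \<Rightarrow> real set" assume A: "\<And>i. i \<in> {1..q} \<Longrightarrow> A i \<in> sets lborel"
  let ?T = "\<lambda>x. \<lambda>i\<in>{1..q}. c i + x i"
  have [measurable]: "?T \<in> lebesgue_R q \<rightarrow>\<^sub>M PB q" by measurable
  have [measurable]: "Pi\<^sub>E {1..q} A \<in> sets (PB q)"
    using A by (intro sets_PiM_I_finite) auto
  have pre: "(\<lambda>t. c i + t) -` A i \<in> sets lborel" if "i \<in> {1..q}" for i
    using measurable_sets[of "\<lambda>t. c i + t" borel borel "A i"] A[OF that] by simp
  have "emeasure (distr (lebesgue_R q) (PB q) ?T) (Pi\<^sub>E {1..q} A)
      = emeasure (lebesgue_R q) (?T -` Pi\<^sub>E {1..q} A \<inter> space (lebesgue_R q))"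
    by (rule emeasure_distr) measurable
  also have "?T -` Pi\<^sub>E {1..q} A \<inter> space (lebesgue_R q) = Pi\<^sub>E {1..q} (\<lambda>i. (\<lambda>t. c i + t) -` A i)"
    by (auto simp: space_lebesgue_R Rvec_def PiE_def Pi_def extensional_def)
  also have "emeasure (lebesgue_R q) \<dots> = (\<Prod>i\<in>{1..q}. emeasure lborel ((\<lambda>t. c i + t) -` A i))"
    using pre by (intro lborel_prod.emeasure_PiM) auto
  also have "\<dots> = (\<Prod>i\<in>{1..q}. emeasure lborel (A i))"
  proof (rule prod.cong[OF refl])
    fix i assume i: "i \<in> {1..q}"
    have "emeasure lborel (A i) = emeasure (distr lborel borel ((+) (c i))) (A i)"
      by (simp add: lborel_distr_plus)
    also have "\<dots> = emeasure lborel ((\<lambda>t. c i + t) -` A i)"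
      using A[OF i] by (subst emeasure_distr) auto
    finally show "emeasure lborel ((\<lambda>t. c i + t) -` A i) = emeasure lborel (A i)" by simp
  qed
  finally show "emeasure (distr (lebesgue_R q) (PB q) ?T) (Pi\<^sub>E {1..q} A)
      = (\<Prod>i\<in>{1..q}. emeasure lborel (A i))" .
qed (auto simp: sets_lebesgue_R)

text \<open>Translation carries every ball to the ball of the same radius about the origin; its mass
  is finite because the ball lies in a cube.\<close>

lemma ball_uniform_lebesgue_R:
  "ball_uniform q (Rvec q) (\<lambda>r. emeasure (lebesgue_R q) (eball q (\<lambda>i\<in>{1..q}. 0) r)) (lebesgue_R q)"
proof
  show "AE x in lebesgue_R q. x \<in> Rvec q"
    by (rule AE_I2) (simp add: space_lebesgue_R)
  fix x and r :: real
  assume x: "x \<in> Rvec q" and r: "r > 0"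
  let ?T = "\<lambda>y. \<lambda>i\<in>{1..q}. x i + y i"
  have [measurable]: "?T \<in> lebesgue_R q \<rightarrow>\<^sub>M PB q" by measurable
  have "emeasure (lebesgue_R q) (eball q x r)
      = emeasure (distr (lebesgue_R q) (PB q) ?T) (eball q x r)"
    by (simp add: lebesgue_R_translation)
  also have "\<dots> = emeasure (lebesgue_R q) (?T -` eball q x r \<inter> space (lebesgue_R q))"
    using eball_sets[OF x] by (intro emeasure_distr) measurable
  also have "?T -` eball q x r \<inter> space (lebesgue_R q) = eball q (\<lambda>i\<in>{1..q}. 0) r"
  proof -
    have "edist q x (?T y) = edist q (\<lambda>i\<in>{1..q}. 0) y" for y
      unfolding edist_def by (rule L2_set_cong) auto
    then show ?thesis by (auto simp: eball_def space_lebesgue_R Rvec_def)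
  qed
  finally show "emeasure (lebesgue_R q) (eball q x r)
      = emeasure (lebesgue_R q) (eball q (\<lambda>i\<in>{1..q}. 0) r)" .
next
  fix r :: real assume r: "r > 0"
  have "eball q (\<lambda>i\<in>{1..q}. 0) r \<subseteq> Pi\<^sub>E {1..q} (\<lambda>_. {-r..r})"
  proof
    fix y assume y: "y \<in> eball q (\<lambda>i\<in>{1..q}. 0) r"
    have "y i \<in> {-r..r}" if "i \<in> {1..q}" for i
      using abs_diff_le_edist[OF that, of "\<lambda>i\<in>{1..q}. 0" y] y that by (auto simp: eball_def)
    moreover have "y \<in> extensional {1..q}" using y by (simp add: eball_def Rvec_def PiE_def)
    ultimately show "y \<in> Pi\<^sub>E {1..q} (\<lambda>_. {-r..r})" by (simp add: PiE_iff)
  qed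
  then have "emeasure (lebesgue_R q) (eball q (\<lambda>i\<in>{1..q}. 0) r)
      \<le> emeasure (lebesgue_R q) (Pi\<^sub>E {1..q} (\<lambda>_. {-r..r}))"
    by (intro emeasure_mono sets_PiM_I_finite) auto
  also have "\<dots> = (\<Prod>i\<in>{1..q}. emeasure lborel {-r..r})"
    by (intro lborel_prod.emeasure_PiM) auto
  also have "\<dots> < \<infinity>" using r by (simp add: ennreal_power less_top[symmetric])
  finally show "emeasure (lebesgue_R q) (eball q (\<lambda>i\<in>{1..q}. 0) r) < \<infinity>" .
qed (auto simp: sets_lebesgue_R)

text \<open>The preimage of a ball about \<open>x\<close> is the ball of the same radius about the
  transpose applied to \<open>x\<close>. The image measure therefore has the same ball masses, and
  these determine it.\<close>

lemma lebesgue_R_orthogonal: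
  assumes A: "orthogonal_mat q A"
  shows "distr (lebesgue_R q) (PB q) (mat_vec q A) = lebesgue_R q"
proof (rule ball_uniform_unique[OF _ ball_uniform_lebesgue_R])
  interpret ball_uniform q "Rvec q" "\<lambda>r. emeasure (lebesgue_R q) (eball q (\<lambda>i\<in>{1..q}. 0) r)"
    "lebesgue_R q" by (rule ball_uniform_lebesgue_R)
  have [measurable]: "mat_vec q A \<in> lebesgue_R q \<rightarrow>\<^sub>M PB q" by measurable
  show "ball_uniform q (Rvec q) (\<lambda>r. emeasure (lebesgue_R q) (eball q (\<lambda>i\<in>{1..q}. 0) r))
      (distr (lebesgue_R q) (PB q) (mat_vec q A))"
  proof
    show "AE x in distr (lebesgue_R q) (PB q) (mat_vec q A). x \<in> Rvec q"
      by (rule AE_I2) (simp add: space_PB)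
    fix x and r :: real assume x: "x \<in> Rvec q" and r: "r > 0"
    let ?x = "mat_vec q (\<lambda>i j. A j i) x"
    have "emeasure (distr (lebesgue_R q) (PB q) (mat_vec q A)) (eball q x r)
        = emeasure (lebesgue_R q) (mat_vec q A -` eball q x r \<inter> space (lebesgue_R q))"
      using eball_sets[OF x] by (intro emeasure_distr) measurable
    also have "mat_vec q A -` eball q x r \<inter> space (lebesgue_R q) = eball q ?x r"
      using edist_orthogonal[OF A, of ?x] orthogonal_transpose_right[OF A x]
      by (auto simp: eball_def space_lebesgue_R)
    also have "emeasure (lebesgue_R q) \<dots> = emeasure (lebesgue_R q) (eball q (\<lambda>i\<in>{1..q}. 0) r)"
      using r by (intro ball) auto
    finally show "emeasure (distr (lebesgue_R q) (PB q) (mat_vec q A)) (eball q x r)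
        = emeasure (lebesgue_R q) (eball q (\<lambda>i\<in>{1..q}. 0) r)" .
  qed (use finite_h in auto)
qed

section \<open>Standard Gaussian measure and its orthogonal invariance\<close>

abbreviation std_normal :: "real measure" where
  "std_normal \<equiv> density lborel std_normal_density"

definition gauss :: "nat \<Rightarrow> (nat \<Rightarrow> real) measure" where
  "gauss q = (\<Pi>\<^sub>M i\<in>{1..q}. std_normal)"

lemma prob_space_std_normal: "prob_space std_normal"
  by (rule prob_space_normal_density) simp

interpretation std_normal_prod: product_sigma_finite "\<lambda>_::nat. std_normal"
  by (intro product_sigma_finite.intro prob_space_imp_sigma_finite prob_space_std_normal)

lemma sets_gauss [measurable_cong]: "sets (gauss q) = sets (PB q)"
  unfolding gauss_def by (intro sets_PiM_cong) auto

lemma space_gauss: "space (gauss q) = Rvec q"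
  by (simp add: gauss_def space_PiM Rvec_def)

lemma prob_space_gauss: "prob_space (gauss q)"
  unfolding gauss_def by (intro prob_space_PiM prob_space_std_normal)

text \<open>The product of the one-dimensional densities depends on \<open>x\<close> only through
  its norm, which is the source of the rotation invariance.\<close>

lemma gauss_eq_density:
  "gauss q = density (lebesgue_R q) (\<lambda>x. ennreal ((1 / sqrt (2 * pi)) ^ q * exp (- dotp q x x / 2)))"
proof -
  have prod_eq: "(\<Prod>i\<in>{1..q}. std_normal_density (x i))
      = (1 / sqrt (2 * pi)) ^ q * exp (- dotp q x x / 2)" for x
    by (simp add: std_normal_density_def prod.distrib dotp_def exp_sum[symmetric]
        sum_negf sum_divide_distrib[symmetric] power2_eq_square prod_dividef power_divide)
  have "density (lebesgue_R q) (\<lambda>x. ennreal (\<Prod>i\<in>{1..q}. std_normal_density (x i))) = gauss q"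
    unfolding gauss_def
  proof (rule std_normal_prod.PiM_eqI)
    fix A :: "nat \<Rightarrow> real set" assume A: "\<And>i. i \<in> {1..q} \<Longrightarrow> A i \<in> sets std_normal"
    have PA: "Pi\<^sub>E {1..q} A \<in> sets (lebesgue_R q)"
      using A by (intro sets_PiM_I_finite) auto
    have "emeasure (density (lebesgue_R q) (\<lambda>x. ennreal (\<Prod>i\<in>{1..q}. std_normal_density (x i))))
          (Pi\<^sub>E {1..q} A)
        = (\<integral>\<^sup>+x. ennreal (\<Prod>i\<in>{1..q}. std_normal_density (x i)) * indicator (Pi\<^sub>E {1..q} A) x
            \<partial>lebesgue_R q)"
      using PA by (intro emeasure_density) auto
    also have "\<dots> = (\<integral>\<^sup>+x. (\<Prod>i\<in>{1..q}. ennreal (std_normal_density (x i)) * indicator (A i) (x i))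
            \<partial>lebesgue_R q)"
    proof (rule nn_integral_cong)
      fix x assume "x \<in> space (lebesgue_R q)"
      then have x: "x \<in> extensional {1..q}" by (auto simp: space_PiM PiE_def)
      have "indicator (Pi\<^sub>E {1..q} A) x = (\<Prod>i\<in>{1..q}. indicator (A i) (x i) :: ennreal)"
        using x by (auto simp: indicator_def PiE_def Pi_def prod_zero_iff)
      then show "ennreal (\<Prod>i\<in>{1..q}. std_normal_density (x i)) * indicator (Pi\<^sub>E {1..q} A) x
          = (\<Prod>i\<in>{1..q}. ennreal (std_normal_density (x i)) * indicator (A i) (x i))"
        by (simp add: prod.distrib prod_ennreal)
    qed
    also have "\<dots> = (\<Prod>i\<in>{1..q}. \<integral>\<^sup>+t. ennreal (std_normal_density t) * indicator (A i) t \<partial>lborel)"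
      using A by (intro lborel_prod.product_nn_integral_prod) auto
    also have "\<dots> = (\<Prod>i\<in>{1..q}. emeasure std_normal (A i))"
      using A by (intro prod.cong refl) (simp add: emeasure_density)
    finally show "emeasure (density (lebesgue_R q)
        (\<lambda>x. ennreal (\<Prod>i\<in>{1..q}. std_normal_density (x i)))) (Pi\<^sub>E {1..q} A)
      = (\<Prod>i\<in>{1..q}. emeasure std_normal (A i))" .
  qed (use sets_gauss[of q] in \<open>auto simp: sets_lebesgue_R gauss_def\<close>)
  then show ?thesis by (simp only: prod_eq)
qed

lemma gauss_orthogonal:
  assumes A: "orthogonal_mat q A"
  shows "distr (gauss q) (PB q) (mat_vec q A) = gauss q"
proof -
  let ?F = "\<lambda>x. ennreal ((1 / sqrt (2 * pi)) ^ q * exp (- dotp q x x / 2))"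
  have F: "?F \<in> borel_measurable (PB q)" unfolding dotp_def by measurable
  \<comment> \<open>Because \<open>A\<close> preserves the norm, the density equals its own
    composition with \<open>mat_vec q A\<close>. In this form it can be moved outside the image
    measure.\<close>
  have "distr (gauss q) (PB q) (mat_vec q A)
      = distr (density (lebesgue_R q) (\<lambda>x. ?F (mat_vec q A x))) (PB q) (mat_vec q A)"
    unfolding gauss_eq_density
    by (intro distr_cong density_cong AE_I2)
      (use F in \<open>auto simp: dotp_orthogonal[OF A] space_lebesgue_R cong: measurable_cong_sets\<close>)
  also have "\<dots> = density (distr (lebesgue_R q) (PB q) (mat_vec q A)) ?F"
    using F by (intro density_distr[symmetric]) auto
  also have "\<dots> = gauss q"
    by (simp add: lebesgue_R_orthogonal[OF A] gauss_eq_density)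
  finally show ?thesis .
qed

section \<open>Uniqueness of the uniform measure on the sphere\<close>

lemma dotp_ones: "dotp q v (ones q) = (\<Sum>i=1..q. v i)"
  by (simp add: dotp_def ones_def)

lemma hyperplane_eq: "hyperplane q = {v \<in> Rvec q. (\<Sum>i=1..q. v i) = 0}"
  by (simp add: hyperplane_def dotp_ones)

lemma hsphere_sub_Rvec: "hsphere q \<rho> \<subseteq> Rvec q"
  by (auto simp: hsphere_def hyperplane_def)

lemma sets_hsphere [measurable]: "hsphere q \<rho> \<in> sets (PB q)"
proof -
  have "{v \<in> space (PB q). (\<Sum>i=1..q. v i) = 0 \<and> L2_set v {1..q} = \<rho>} \<in> sets (PB q)"
    unfolding L2_set_def by measurable
  also have "{v \<in> space (PB q). (\<Sum>i=1..q. v i) = 0 \<and> L2_set v {1..q} = \<rho>} = hsphere q \<rho>"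
    unfolding space_PB hsphere_def hyperplane_eq by auto
  finally show ?thesis .
qed

lemma rotation_hsphere:
  assumes A: "hyperplane_rotation q A" and v: "v \<in> hsphere q \<rho>"
  shows "mat_vec q A v \<in> hsphere q \<rho>"
  using assms dotp_orthogonal[of q A v v]
  by (auto simp: hsphere_def hyperplane_rotation_def L2_set_eq_dotp hyperplane_def[of q])

text \<open>The Householder reflection that exchanges \<open>x\<close> and \<open>y\<close>.\<close>

lemma ex_rotation:
  assumes x: "x \<in> hsphere q \<rho>" and y: "y \<in> hsphere q \<rho>"
  obtains A where "hyperplane_rotation q A" "mat_vec q A x = y"
proof -
  define u where "u i = x i - y i" for i
  define n where "n = (\<Sum>i=1..q. u i * u i)"
  \<comment> \<open>If \<open>x\<close> and \<open>y\<close> coincide there is no direction to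
    reflect in, and \<open>c = 0\<close> makes \<open>A\<close> the identity matrix.\<close>
  define c where "c = (if n = 0 then 0 else 2 / n)"
  define A where "A i j = (if i = j then 1 else 0) - c * u i * u j" for i j
  \<comment> \<open>Exactly the relation that makes the reflection an involution.\<close>
  have cn: "c * c * n = 2 * c" by (simp add: c_def)
  have app: "(\<Sum>j=1..q. A i j * v j) = v i - c * u i * (\<Sum>j=1..q. u j * v j)"
    if "i \<in> {1..q}" for i v
  proof -
    have "(\<Sum>j=1..q. A i j * v j)
        = (\<Sum>j=1..q. (if i = j then v j else 0)) - (\<Sum>j=1..q. c * u i * (u j * v j))"
      unfolding A_def sum_subtractf[symmetric] by (rule sum.cong) (auto simp: algebra_simps)
    then show ?thesis using that by (simp add: sum_distrib_left)
  qed
  have sym: "A i j = A j i" for i j by (auto simp: A_def)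
  have orth: "orthogonal_mat q A"
    unfolding orthogonal_mat_def
  proof (intro ballI)
    fix i j assume ij: "i \<in> {1..q}" "j \<in> {1..q}"
    have uA: "(\<Sum>k=1..q. u k * A k j) = u j - c * u j * n"
    proof -
      have "(\<Sum>k=1..q. u k * A k j) = (\<Sum>k=1..q. A j k * u k)"
        by (rule sum.cong[OF refl]) (metis mult.commute sym)
      then show ?thesis using app[OF ij(2), of u] by (simp only: n_def)
    qed
    have "(\<Sum>k=1..q. A k i * A k j) = A i j - c * u i * (\<Sum>k=1..q. u k * A k j)"
      unfolding app[OF ij(1), of "\<lambda>k. A k j", symmetric] by (simp only: sym[of i])
    also have "\<dots> = (if i = j then 1 else 0) + (c * c * n - 2 * c) * (u i * u j)"
      unfolding uA by (simp add: A_def algebra_simps)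
    finally show "(\<Sum>k=1..q. A k i * A k j) = (if i = j then 1 else 0)"
      using cn by simp
  qed
  \<comment> \<open>The direction of reflection lies in the hyperplane, so subtracting multiples of
    it keeps coordinate sums at zero.\<close>
  have u0: "(\<Sum>i=1..q. u i) = 0"
    using x y by (simp add: u_def sum_subtractf hsphere_def hyperplane_eq)
  have "mat_vec q A ` hyperplane q \<subseteq> hyperplane q"
  proof
    fix w assume "w \<in> mat_vec q A ` hyperplane q"
    then obtain v where v: "(\<Sum>i=1..q. v i) = 0" and w: "w = mat_vec q A v"
      by (auto simp: hyperplane_eq)
    have "(\<Sum>i=1..q. w i) = (\<Sum>i=1..q. v i - c * (\<Sum>j=1..q. u j * v j) * u i)"
      unfolding w by (rule sum.cong) (simp_all add: mat_vec_apply app mult.assoc mult.commute[of "u _"])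
    also have "\<dots> = 0" by (simp add: sum_subtractf v u0 flip: sum_distrib_left)
    finally show "w \<in> hyperplane q" by (simp add: hyperplane_eq w)
  qed
  with orth have rot: "hyperplane_rotation q A" by (simp add: hyperplane_rotation_def)
  have "mat_vec q A x = y"
  proof (rule Rvec_eqI)
    fix i assume i: "i \<in> {1..q}"
    have "sqrt (dotp q x x) = sqrt (dotp q y y)"
      using x y by (simp add: hsphere_def L2_set_eq_dotp)
    then have "dotp q x x = dotp q y y" by simp
    \<comment> \<open>Equal norms give \<open>2 (u . x) = |u|\<^sup>2\<close>, so the reflection
      subtracts exactly \<open>u = x - y\<close> from \<open>x\<close>.\<close>
    then have ux: "2 * (\<Sum>j=1..q. u j * x j) = n"
      by (simp add: n_def u_def dotp_def algebra_simps sum_subtractf sum.distrib sum_distrib_left)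
    have "c * u i * (\<Sum>j=1..q. u j * x j) = u i"
    proof (cases "n = 0")
      case True
      then have "u i * u i = 0"
        using i unfolding n_def by (subst (asm) sum_nonneg_eq_0_iff) auto
      then show ?thesis by simp
    next
      case False
      then show ?thesis using ux by (simp add: c_def field_simps)
    qed
    then have "mat_vec q A x i = x i - u i" using i by (simp only: mat_vec_apply app)
    then show "mat_vec q A x i = y i" by (simp add: u_def)
  qed (use y hsphere_sub_Rvec in auto)
  with rot show ?thesis by (rule that)
qed

context
  fixes q :: nat and \<rho> :: real and U :: "(nat \<Rightarrow> real) measure"
  assumes U: "is_uniform_on_hsphere q \<rho> U"
begin

lemma uniform_sets: "sets U = sets (restrict_space (PB q) (hsphere q \<rho>))"
  and uniform_prob: "prob_space U"
  and uniform_rotation: "hyperplane_rotation q A \<Longrightarrow> distr U U (mat_vec q A) = U"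
  using U by (auto simp: is_uniform_on_hsphere_def)

lemma uniform_space: "space U = hsphere q \<rho>"
  using sets_eq_imp_space_eq[OF uniform_sets] hsphere_sub_Rvec[of q \<rho>]
  by (simp add: space_restrict_space space_PB Int_absorb2)

lemma uniform_measurable_id [measurable]: "(\<lambda>x. x) \<in> U \<rightarrow>\<^sub>M PB q"
  by (simp add: measurable_cong_sets[OF uniform_sets refl] measurable_restrict_space1)

lemma uniform_measurable_rotation:
  assumes "hyperplane_rotation q A"
  shows "mat_vec q A \<in> U \<rightarrow>\<^sub>M U"
  unfolding measurable_cong_sets[OF uniform_sets uniform_sets]
  using rotation_hsphere[OF assms] hsphere_sub_Rvec
  by (intro measurable_restrict_space3 measurable_mat_vec) auto

text \<open>Some rotation takes \<open>x\<close> to \<open>y\<close>. It is an isometry that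
  preserves the sphere, so the part of the sphere in the ball about \<open>y\<close> pulls back to
  the part in the ball about \<open>x\<close>.\<close>

lemma emeasure_uniform_ball_cong:
  assumes x: "x \<in> hsphere q \<rho>" and y: "y \<in> hsphere q \<rho>"
  shows "emeasure (distr U (PB q) (\<lambda>x. x)) (eball q x r)
    = emeasure (distr U (PB q) (\<lambda>x. x)) (eball q y r)"
proof -
  obtain A where A: "hyperplane_rotation q A" and Axy: "mat_vec q A x = y"
    using ex_rotation[OF x y] .
  note [measurable] = uniform_measurable_rotation[OF A]
  have orth: "orthogonal_mat q A" using A by (simp add: hyperplane_rotation_def)
  have balls: "eball q x r \<in> sets (PB q)" "eball q y r \<in> sets (PB q)"
    using x y hsphere_sub_Rvec[of q \<rho>] by (auto intro!: eball_sets)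
  have bU: "eball q y r \<inter> space U \<in> sets U"
    using measurable_sets[OF uniform_measurable_id balls(2)] by simp
  have "emeasure (distr U (PB q) (\<lambda>x. x)) (eball q y r) = emeasure U (eball q y r \<inter> space U)"
    using balls(2) by (subst emeasure_distr) auto
  also have "\<dots> = emeasure (distr U U (mat_vec q A)) (eball q y r \<inter> space U)"
    by (simp add: uniform_rotation[OF A])
  also have "\<dots> = emeasure U (mat_vec q A -` (eball q y r \<inter> space U) \<inter> space U)"
    by (rule emeasure_distr[OF uniform_measurable_rotation[OF A] bU])
  also have "mat_vec q A -` (eball q y r \<inter> space U) \<inter> space U = eball q x r \<inter> space U"
    using rotation_hsphere[OF A] edist_orthogonal[OF orth, of x] Axy hsphere_sub_Rvec[of q \<rho>]
    by (auto simp: eball_def uniform_space)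
  also have "emeasure U \<dots> = emeasure (distr U (PB q) (\<lambda>x. x)) (eball q x r)"
    using balls(1) by (subst emeasure_distr) auto
  finally show ?thesis by simp
qed

text \<open>The measure is pushed forward to all of \<open>Rvec q\<close>, where ball-uniform
  measures live. By transitivity of the rotations any point \<open>w\<close> of the sphere can serve
  as the reference centre.\<close>

lemma uniform_ball_uniform:
  assumes w: "w \<in> hsphere q \<rho>"
  shows "ball_uniform q (hsphere q \<rho>)
    (\<lambda>r. emeasure (distr U (PB q) (\<lambda>x. x)) (eball q w r)) (distr U (PB q) (\<lambda>x. x))"
proof
  interpret prob_space U by (rule uniform_prob)
  interpret D: prob_space "distr U (PB q) (\<lambda>x. x)" by (rule prob_space_distr) measurable
  show "AE x in distr U (PB q) (\<lambda>x. x). x \<in> hsphere q \<rho>"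
    by (subst AE_distr_iff) (auto simp: uniform_space space_PB hsphere_sub_Rvec[THEN subsetD]
        Collect_conj_eq Int_absorb2[OF hsphere_sub_Rvec] Int_absorb1[OF hsphere_sub_Rvec])
  show "emeasure (distr U (PB q) (\<lambda>x. x)) (eball q w r) < \<infinity>" for r
    by (simp add: less_top[symmetric])
  show "emeasure (distr U (PB q) (\<lambda>x. x)) (eball q x r)
      = emeasure (distr U (PB q) (\<lambda>x. x)) (eball q w r)" if "x \<in> hsphere q \<rho>" for x r
    by (rule emeasure_uniform_ball_cong[OF that w])
qed (use hsphere_sub_Rvec in auto)

end

lemma uniform_unique:
  assumes U: "is_uniform_on_hsphere q \<rho> U" and V: "is_uniform_on_hsphere q \<rho> V"
  shows "U = V"
proof -
  let ?U = "distr U (PB q) (\<lambda>x. x)" and ?V = "distr V (PB q) (\<lambda>x. x)"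
  note [measurable] = uniform_measurable_id[OF U] uniform_measurable_id[OF V]
  interpret U: prob_space U by (rule uniform_prob[OF U])
  interpret V: prob_space V by (rule uniform_prob[OF V])
  interpret PU: prob_space ?U by (rule U.prob_space_distr) measurable
  interpret PV: prob_space ?V by (rule V.prob_space_distr) measurable
  obtain w where w: "w \<in> hsphere q \<rho>"
    using U.not_empty uniform_space[OF U] by auto
  note bU = uniform_ball_uniform[OF U w] and bV = uniform_ball_uniform[OF V w]
  interpret bU: ball_uniform q "hsphere q \<rho>" "\<lambda>r. emeasure ?U (eball q w r)" ?U by (rule bU)
  interpret bV: ball_uniform q "hsphere q \<rho>" "\<lambda>r. emeasure ?V (eball q w r)" ?V by (rule bV)
  \<comment> \<open>Uniqueness requires both measures to have the same ball masses. Taking the whole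
    space for \<open>G\<close> in the swap yields the mass under \<open>?U\<close>, while the
    integrand is constantly the mass under \<open>?V\<close>.\<close>
  have h: "emeasure ?U (eball q w r) = emeasure ?V (eball q w r)" if r: "r > 0" for r
  proof -
    have "emeasure ?U (eball q w r) = emeasure ?U (eball q w r) * emeasure ?V (space ?V)"
      using PV.emeasure_space_1 by simp
    also have "\<dots> = (\<integral>\<^sup>+x. emeasure ?V (space ?V \<inter> eball q x r) \<partial>?U)"
      by (rule nn_integral_ball_swap[OF bU bV _ r, symmetric]) simp
    also have "\<dots> = (\<integral>\<^sup>+x. emeasure ?V (eball q w r) \<partial>?U)"
    proof (rule nn_integral_cong_AE, use bU.AE_S in eventually_elim)
      fix x assume x: "x \<in> hsphere q \<rho>"
      have "space ?V \<inter> eball q x r = eball q x r" by (auto simp: space_PB eball_def)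
      then show "emeasure ?V (space ?V \<inter> eball q x r) = emeasure ?V (eball q w r)"
        using bV.ball[OF x r] by simp
    qed
    also have "\<dots> = emeasure ?V (eball q w r)" using PU.emeasure_space_1 by simp
    finally show ?thesis .
  qed
  have "ball_uniform q (hsphere q \<rho>) (\<lambda>r. emeasure ?V (eball q w r)) ?U"
    by unfold_locales (use bU.S_sub bU.AE_S bU.ball bV.finite_h h in auto)
  then have UV: "?U = ?V" using bV by (rule ball_uniform_unique)
  show "U = V"
  proof (rule measure_eqI)
    show "sets U = sets V" by (simp add: uniform_sets[OF U] uniform_sets[OF V])
    fix X assume "X \<in> sets U"
    \<comment> \<open>Measurable subsets of the sphere are traces of Borel sets, so equality of the
      pushforwards gives equality of the original measures.\<close>
    then obtain B where B: "B \<in> sets (PB q)" "X = B \<inter> hsphere q \<rho>"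
      by (auto simp: uniform_sets[OF U] sets_restrict_space)
    have "emeasure U X = emeasure ?U B"
      using B by (subst emeasure_distr) (auto simp: uniform_space[OF U])
    also have "\<dots> = emeasure V X"
      unfolding UV using B by (subst emeasure_distr) (auto simp: uniform_space[OF V])
    finally show "emeasure U X = emeasure V X" .
  qed
qed

section \<open>Orthogonal projection to the hyperplane and its commutation with rotations\<close>

lemma project_apply: "i \<in> {1..q} \<Longrightarrow> project q x i = x i - (\<Sum>j=1..q. x j) / real q"
  by (simp add: project_def ones_def)

lemma project_in_Rvec [simp]: "project q x \<in> Rvec q"
  by (simp add: project_def Rvec_def)

lemma project_in_hyperplane: "project q x \<in> hyperplane q"
proof -
  have "(\<Sum>i=1..q. project q x i) = (\<Sum>i=1..q. x i - (\<Sum>j=1..q. x j) / real q)"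
    by (rule sum.cong) (auto simp: project_apply)
  also have "\<dots> = 0" by (simp add: sum_subtractf)
  finally show ?thesis by (simp add: hyperplane_eq)
qed

text \<open>A rotation preserves the hyperplane, hence also its normal line: \<open>ones q\<close>
  is an eigenvector of \<open>A\<close> and of its transpose, with the same eigenvalue
  \<open>c\<close>, which is 1 or -1.\<close>

lemma rotation_ones:
  assumes A: "hyperplane_rotation q A" and q: "q \<ge> 1"
  obtains c where "\<And>j. j \<in> {1..q} \<Longrightarrow> (\<Sum>i=1..q. A i j) = c"
    "\<And>i. i \<in> {1..q} \<Longrightarrow> (\<Sum>j=1..q. A i j) = c"
proof -
  have orth: "orthogonal_mat q A" using A by (simp add: hyperplane_rotation_def)
  define c where "c = (\<Sum>i=1..q. A i 1)"
  have col: "(\<Sum>i=1..q. A i j) = c" if j: "j \<in> {1..q}" for j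
  proof -
    \<comment> \<open>The difference of the unit vectors \<open>j\<close> and 1. Its image has
      coordinate sum zero, so columns \<open>j\<close> and 1 have equal sums.\<close>
    define v where "v = (\<lambda>k\<in>{1..q}. (if k = j then 1 else 0) - (if k = 1 then 1 else 0 :: real))"
    have "(\<Sum>i=1..q. v i)
        = (\<Sum>k=1..q. (if k = j then 1 else 0) - (if k = 1 then 1 else 0 :: real))"
      by (rule sum.cong) (auto simp: v_def)
    also have "\<dots> = 0" using j by (simp add: sum_subtractf)
    finally have "v \<in> hyperplane q" by (simp add: hyperplane_eq v_def Rvec_def)
    then have "mat_vec q A v \<in> hyperplane q"
      using A by (auto simp: hyperplane_rotation_def)
    then have "0 = (\<Sum>i=1..q. mat_vec q A v i)" by (simp add: hyperplane_eq)
    also have "\<dots> = (\<Sum>i=1..q. A i j - A i 1)"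
    proof (rule sum.cong)
      fix i assume i: "i \<in> {1..q}"
      have "(\<Sum>k=1..q. A i k * v k)
          = (\<Sum>k=1..q. (if k = j then A i k else 0) - (if k = 1 then A i k else 0))"
        by (rule sum.cong) (auto simp: v_def)
      also have "\<dots> = A i j - A i 1" using j by (simp add: sum_subtractf)
      finally show "mat_vec q A v i = A i j - A i 1" using i by (simp add: mat_vec_apply)
    qed simp
    finally show ?thesis by (simp add: sum_subtractf c_def)
  qed
  \<comment> \<open>The transpose maps \<open>ones q\<close> to \<open>c\<close> times itself and
    preserves its norm, so \<open>c * c = 1\<close>.\<close>
  have "dotp q (mat_vec q (\<lambda>i j. A j i) (ones q)) (mat_vec q (\<lambda>i j. A j i) (ones q))
      = dotp q (ones q) (ones q)"
    using orthogonal_transpose_right[OF orth, of "ones q"]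
    by (simp add: dotp_mat_vec ones_def Rvec_def)
  moreover have "dotp q (mat_vec q (\<lambda>i j. A j i) (ones q)) (mat_vec q (\<lambda>i j. A j i) (ones q))
      = (\<Sum>i=1..q. c * c)"
    unfolding dotp_def by (rule sum.cong) (auto simp: mat_vec_apply ones_def col)
  ultimately have cc: "c * c = 1" using q by (simp add: dotp_ones) (simp add: ones_def)
  have "(\<Sum>j=1..q. A i j) = c" if i: "i \<in> {1..q}" for i
  proof -
    have "1 = mat_vec q A (mat_vec q (\<lambda>i j. A j i) (ones q)) i"
      using orthogonal_transpose_right[OF orth, of "ones q"] i by (simp add: ones_def Rvec_def)
    also have "\<dots> = (\<Sum>j=1..q. A i j * c)"
      using i by (simp add: mat_vec_apply) (rule sum.cong, auto simp: mat_vec_apply ones_def col)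
    also have "\<dots> = c * (\<Sum>j=1..q. A i j)" by (simp add: sum_distrib_left mult.commute)
    finally have "c * 1 = c * c * (\<Sum>j=1..q. A i j)" by (simp add: mult.assoc)
    then show ?thesis by (simp add: cc)
  qed
  with col show ?thesis by (rule that)
qed

text \<open>Projecting subtracts the mean. Since row and column sums of \<open>A\<close> share the
  value \<open>c\<close>, both sides subtract \<open>c\<close> times the mean of
  \<open>x\<close>.\<close>

lemma rotation_project:
  assumes A: "hyperplane_rotation q A"
  shows "project q (mat_vec q A x) = mat_vec q A (project q x)"
proof (rule Rvec_eqI)
  fix i assume i: "i \<in> {1..q}"
  then have "q \<ge> 1" by auto
  then obtain c where c: "\<And>j. j \<in> {1..q} \<Longrightarrow> (\<Sum>i=1..q. A i j) = c"
      "\<And>i. i \<in> {1..q} \<Longrightarrow> (\<Sum>j=1..q. A i j) = c"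
    using rotation_ones[OF A] by metis
  have "(\<Sum>k=1..q. mat_vec q A x k) = (\<Sum>k=1..q. \<Sum>j=1..q. A k j * x j)"
    by (simp add: mat_vec_apply)
  also have "\<dots> = (\<Sum>j=1..q. \<Sum>k=1..q. A k j * x j)" by (rule sum.swap)
  also have "\<dots> = c * (\<Sum>j=1..q. x j)"
    by (simp add: c sum_distrib_left flip: sum_distrib_right)
  finally have s: "(\<Sum>k=1..q. mat_vec q A x k) = c * (\<Sum>j=1..q. x j)" .
  have "mat_vec q A (project q x) i = (\<Sum>j=1..q. A i j * x j - A i j * ((\<Sum>j=1..q. x j) / real q))"
    using i by (simp add: mat_vec_apply project_apply right_diff_distrib)
  also have "\<dots> = (\<Sum>j=1..q. A i j * x j) - (\<Sum>j=1..q. A i j) * ((\<Sum>j=1..q. x j) / real q)"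
    by (simp only: sum_subtractf sum_distrib_right)
  also have "\<dots> = mat_vec q A x i - c * (\<Sum>j=1..q. x j) / real q"
    by (simp only: mat_vec_apply[OF i] c(2)[OF i] times_divide_eq_right)
  also have "\<dots> = project q (mat_vec q A x) i"
    by (simp only: project_apply[OF i] s)
  finally show "project q (mat_vec q A x) i = mat_vec q A (project q x) i" by (rule sym)
qed simp_all

section \<open>The uniform measure as a projected Gaussian\<close>

text \<open>Fubini with coordinate \<open>i\<close> integrated first. It serves both the null set of
  equal coordinates and the independence of one coordinate from the rest.\<close>

lemma emeasure_gauss_split:
  assumes i: "i \<in> {1..q}" and E: "E \<in> sets (PB q)"
  shows "emeasure (gauss q) E
    = (\<integral>\<^sup>+x. (\<integral>\<^sup>+y. indicator E (x(i := y)) \<partial>std_normal) \<partial>(\<Pi>\<^sub>M j\<in>{1..q} - {i}. std_normal))"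
proof -
  have ins: "insert i ({1..q} - {i}) = {1..q}" using i by auto
  have G: "gauss q = (\<Pi>\<^sub>M j\<in>insert i ({1..q} - {i}). std_normal)"
    by (simp only: ins gauss_def)
  have "emeasure (gauss q) E = (\<integral>\<^sup>+x. indicator E x \<partial>gauss q)"
    using E by (simp add: sets_gauss)
  also have "\<dots>
    = (\<integral>\<^sup>+x. (\<integral>\<^sup>+y. indicator E (x(i := y)) \<partial>std_normal) \<partial>(\<Pi>\<^sub>M j\<in>{1..q} - {i}. std_normal))"
    unfolding G
  proof (rule std_normal_prod.product_nn_integral_insert)
    show "indicator E \<in> borel_measurable (\<Pi>\<^sub>M j\<in>insert i ({1..q} - {i}). std_normal)"
      unfolding ins using E sets_gauss[of q] by (auto simp: gauss_def intro!: borel_measurable_indicator)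
  qed auto
  finally show ?thesis .
qed

lemma AE_std_normal_neq: "AE y in std_normal. y \<noteq> c"
  by (subst AE_density) (auto intro: eventually_mono[OF AE_lborel_singleton])

text \<open>With the other coordinates fixed, equality confines coordinate \<open>i\<close> to a
  single value. Consequently a Gaussian vector almost surely has a nonzero projection.\<close>

lemma AE_gauss_coords_neq:
  assumes ij: "i \<in> {1..q}" "j \<in> {1..q}" "i \<noteq> j"
  shows "AE x in gauss q. x i \<noteq> x j"
proof (rule AE_I')
  let ?E = "{x \<in> space (PB q). x i = x j}"
  have E: "?E \<in> sets (PB q)" using ij by measurable
  have "(\<integral>\<^sup>+y. indicator ?E (x(i := y)) \<partial>std_normal) = 0" for x
  proof -
    have "(\<integral>\<^sup>+y. indicator ?E (x(i := y)) \<partial>std_normal) = (\<integral>\<^sup>+y. 0 \<partial>std_normal)"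
      by (rule nn_integral_cong_AE, use AE_std_normal_neq[of "x j"] in eventually_elim)
        (use ij in auto)
    then show ?thesis by simp
  qed
  then have "emeasure (gauss q) ?E = 0"
    using emeasure_gauss_split[OF ij(1) E] by simp
  then show "?E \<in> null_sets (gauss q)" using E by (simp add: null_sets_def sets_gauss)
qed (auto simp: space_gauss space_PB)

text \<open>The value \<open>w\<close> is only taken on a null set.\<close>

definition to_sphere ::
    "nat \<Rightarrow> real \<Rightarrow> (nat \<Rightarrow> real) \<Rightarrow> (nat \<Rightarrow> real) \<Rightarrow> nat \<Rightarrow> real" where
  "to_sphere q \<rho> w x =
    (if L2_set (project q x) {1..q} = 0 then w
     else (\<lambda>i\<in>{1..q}. \<rho> / L2_set (project q x) {1..q} * project q x i))"

lemma measurable_project [measurable]: "project q \<in> PB q \<rightarrow>\<^sub>M PB q"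
  unfolding project_def ones_def by measurable

lemma to_sphere_in_hsphere:
  assumes w: "w \<in> hsphere q \<rho>" and \<rho>: "\<rho> \<ge> 0"
  shows "to_sphere q \<rho> w x \<in> hsphere q \<rho>"
proof (cases "L2_set (project q x) {1..q} = 0")
  case False
  let ?N = "L2_set (project q x) {1..q}"
  let ?v = "\<lambda>i\<in>{1..q}. \<rho> / ?N * project q x i"
  have N: "?N > 0" using False L2_set_nonneg[of "project q x" "{1..q}"] by linarith
  have "(\<Sum>i=1..q. ?v i) = \<rho> / ?N * (\<Sum>i=1..q. project q x i)"
    by (simp add: sum_distrib_left)
  also have "\<dots> = 0" using project_in_hyperplane[of q x] by (simp add: hyperplane_eq)
  finally have "?v \<in> hyperplane q" by (simp add: hyperplane_eq Rvec_def)
  moreover have "L2_set ?v {1..q} = \<rho>"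
  proof -
    have "L2_set ?v {1..q} = L2_set (\<lambda>i. \<rho> / ?N * project q x i) {1..q}"
      by (rule L2_set_cong) auto
    also have "\<dots> = \<rho> / ?N * ?N"
      using N \<rho> by (intro L2_set_right_distrib[symmetric]) simp
    finally show ?thesis using N by simp
  qed
  ultimately show ?thesis using False by (simp add: to_sphere_def hsphere_def)
qed (simp add: to_sphere_def w)

lemma measurable_to_sphere:
  assumes w: "w \<in> hsphere q \<rho>" and \<rho>: "\<rho> \<ge> 0"
  shows "to_sphere q \<rho> w \<in> PB q \<rightarrow>\<^sub>M restrict_space (PB q) (hsphere q \<rho>)"
proof (rule measurable_restrict_space2)
  have [measurable]: "(\<lambda>_. w) \<in> PB q \<rightarrow>\<^sub>M PB q"
    by (rule measurable_const) (use w hsphere_sub_Rvec in \<open>auto simp: space_PB\<close>)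
  have comp: "(\<lambda>x. project q x i) \<in> borel_measurable (PB q)" if "i \<in> {1..q}" for i
    by (rule measurable_compose[OF measurable_project measurable_component_singleton[OF that]])
  have [measurable]: "(\<lambda>x. L2_set (project q x) {1..q}) \<in> borel_measurable (PB q)"
    unfolding L2_set_def 
    by (intro measurable_compose[OF _ borel_measurable_sqrt] borel_measurable_sum borel_measurable_power comp)
  have [measurable]: "(\<lambda>x. \<lambda>i\<in>{1..q}. \<rho> / L2_set (project q x) {1..q} * project q x i)
      \<in> PB q \<rightarrow>\<^sub>M PB q"
    by (intro measurable_restrict borel_measurable_times comp) measurable
  show "to_sphere q \<rho> w \<in> PB q \<rightarrow>\<^sub>M PB q"
    unfolding to_sphere_def by measurable
qed (use to_sphere_in_hsphere[OF w \<rho>] in auto)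

text \<open>Rotations commute with the projection, preserve its norm and are linear. The norm must
  be nonzero because the default value \<open>w\<close> need not be fixed by
  \<open>A\<close>.\<close>

lemma to_sphere_rotation:
  assumes A: "hyperplane_rotation q A" and N: "L2_set (project q x) {1..q} \<noteq> 0"
  shows "to_sphere q \<rho> w (mat_vec q A x) = mat_vec q A (to_sphere q \<rho> w x)"
proof -
  have orth: "orthogonal_mat q A" using A by (simp add: hyperplane_rotation_def)
  have N': "L2_set (project q (mat_vec q A x)) {1..q} = L2_set (project q x) {1..q}"
    by (simp add: rotation_project[OF A] L2_set_eq_dotp dotp_orthogonal[OF orth])
  have "to_sphere q \<rho> w (mat_vec q A x)
      = (\<lambda>i\<in>{1..q}. \<rho> / L2_set (project q x) {1..q} * mat_vec q A (project q x) i)"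
    using N by (simp add: to_sphere_def N') (simp add: rotation_project[OF A])
  also have "\<dots> = mat_vec q A (to_sphere q \<rho> w x)"
  proof (rule Rvec_eqI)
    fix i assume i: "i \<in> {1..q}"
    define c where "c = \<rho> / L2_set (project q x) {1..q}"
    have "mat_vec q A (to_sphere q \<rho> w x) i = (\<Sum>j=1..q. A i j * (c * project q x j))"
      using i N by (simp add: mat_vec_apply to_sphere_def c_def)
    also have "\<dots> = c * mat_vec q A (project q x) i"
      by (simp only: mat_vec_apply[OF i] sum_distrib_left mult.left_commute)
    finally show "(\<lambda>i\<in>{1..q}. \<rho> / L2_set (project q x) {1..q} * mat_vec q A (project q x) i) i
        = mat_vec q A (to_sphere q \<rho> w x) i" using i by (simp add: c_def)
  qed (unfold Rvec_def mat_vec_def, auto)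
  finally show ?thesis .
qed

lemma project_norm_neq_0:
  assumes "i \<in> {1..q}" "j \<in> {1..q}" "x i \<noteq> x j"
  shows "L2_set (project q x) {1..q} \<noteq> 0"
proof
  assume "L2_set (project q x) {1..q} = 0"
  then have "project q x i = 0" "project q x j = 0" using assms by (simp_all add: L2_set_eq_0_iff)
  with assms show False by (simp add: project_apply)
qed

text \<open>The normalized projection of a Gaussian vector is rotation invariant, which proves
  existence; together with uniqueness this evaluates the definite description.\<close>

lemma uniform_hsphere_eq:
  assumes q: "q \<ge> 2" and w: "w \<in> hsphere q \<rho>" and \<rho>: "\<rho> \<ge> 0"
  shows "uniform_hsphere q \<rho>
    = distr (gauss q) (restrict_space (PB q) (hsphere q \<rho>)) (to_sphere q \<rho> w)"
    (is "_ = ?U")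
proof -
  let ?R = "restrict_space (PB q) (hsphere q \<rho>)"
  have T[measurable]: "to_sphere q \<rho> w \<in> gauss q \<rightarrow>\<^sub>M ?R"
    using measurable_to_sphere[OF w \<rho>] by (simp add: measurable_cong_sets[OF sets_gauss refl])
  have "distr ?U ?U (mat_vec q A) = ?U" if A: "hyperplane_rotation q A" for A
  proof -
    have orth: "orthogonal_mat q A" using A by (simp add: hyperplane_rotation_def)
    have MR[measurable]: "mat_vec q A \<in> ?R \<rightarrow>\<^sub>M ?R"
      using rotation_hsphere[OF A] by (intro measurable_restrict_space3 measurable_mat_vec) auto
    have MG[measurable]: "mat_vec q A \<in> gauss q \<rightarrow>\<^sub>M gauss q"
      using measurable_mat_vec by (simp add: measurable_cong_sets[OF sets_gauss sets_gauss])
    have "distr ?U ?U (mat_vec q A) = distr ?U ?R (mat_vec q A)"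
      by (rule distr_cong) auto
    also have "\<dots> = distr (gauss q) ?R (\<lambda>x. mat_vec q A (to_sphere q \<rho> w x))"
      by (subst distr_distr) (auto simp: comp_def)
    also have "\<dots> = distr (gauss q) ?R (\<lambda>x. to_sphere q \<rho> w (mat_vec q A x))"
    proof (rule distr_cong_AE)
      \<comment> \<open>The bound \<open>q \<ge> 2\<close> provides two coordinates that almost
        surely differ, so the default value is taken only on a null set.\<close>
      have "1 \<in> {1..q}" "2 \<in> {1..q}" "(1::nat) \<noteq> 2" using q by auto
      from AE_gauss_coords_neq[OF this] project_norm_neq_0[OF this(1,2)]
      show "AE x in gauss q. mat_vec q A (to_sphere q \<rho> w x) = to_sphere q \<rho> w (mat_vec q A x)"
        by (auto elim!: eventually_mono simp: to_sphere_rotation[OF A])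
    qed (auto intro: measurable_compose[OF T MR] measurable_compose[OF MG T])
    also have "\<dots> = distr (distr (gauss q) (gauss q) (mat_vec q A)) ?R (to_sphere q \<rho> w)"
      by (subst distr_distr) (auto simp: comp_def)
    also have "distr (gauss q) (gauss q) (mat_vec q A) = gauss q"
      using gauss_orthogonal[OF orth] distr_cong[OF refl sets_gauss[of q], of "gauss q"] by simp
    finally show ?thesis .
  qed
  then have U: "is_uniform_on_hsphere q \<rho> ?U"
    unfolding is_uniform_on_hsphere_def
    using prob_space.prob_space_distr[OF prob_space_gauss T] by auto
  show ?thesis
    unfolding uniform_hsphere_def by (rule the_equality, rule U, rule uniform_unique[OF _ U])
qed

text \<open>Turns sphere measures into Gaussian probabilities. The measurability of the pulled-back
  event is needed for monotonicity arguments.\<close>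

lemma measure_uniform_hsphere:
  assumes q: "q \<ge> 2" and w: "w \<in> hsphere q \<rho>" and \<rho>: "\<rho> \<ge> 0"
    and X: "X \<in> sets (PB q)" "X \<subseteq> hsphere q \<rho>"
  shows "measure (uniform_hsphere q \<rho>) X = measure (gauss q) {x \<in> Rvec q. to_sphere q \<rho> w x \<in> X}"
    and "{x \<in> Rvec q. to_sphere q \<rho> w x \<in> X} \<in> sets (gauss q)"
proof -
  have T: "to_sphere q \<rho> w \<in> gauss q \<rightarrow>\<^sub>M restrict_space (PB q) (hsphere q \<rho>)"
    using measurable_to_sphere[OF w \<rho>] by (simp add: measurable_cong_sets[OF sets_gauss refl])
  have XR: "X \<in> sets (restrict_space (PB q) (hsphere q \<rho>))"
    using X by (auto simp: sets_restrict_space)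
  have eq: "to_sphere q \<rho> w -` X \<inter> space (gauss q) = {x \<in> Rvec q. to_sphere q \<rho> w x \<in> X}"
    by (auto simp: space_gauss)
  show "measure (uniform_hsphere q \<rho>) X = measure (gauss q) {x \<in> Rvec q. to_sphere q \<rho> w x \<in> X}"
    unfolding uniform_hsphere_eq[OF q w \<rho>] measure_distr[OF T XR] eq ..
  show "{x \<in> Rvec q. to_sphere q \<rho> w x \<in> X} \<in> sets (gauss q)"
    using measurable_sets[OF T XR] by (simp only: eq)
qed

section \<open>Probability estimates for Gaussian vectors\<close>

lemma nn_integral_std_normal_square: "(\<integral>\<^sup>+t. ennreal (t\<^sup>2) \<partial>std_normal) = 1"
proof -
  have "(\<integral>\<^sup>+t. ennreal (t\<^sup>2) \<partial>std_normal) = (\<integral>\<^sup>+t. ennreal (std_normal_density t * t ^ (2 * 1)) \<partial>lborel)"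
    by (subst nn_integral_density) (auto simp: ennreal_mult)
  also have "\<dots> = ennreal (\<integral>t. std_normal_density t * t ^ (2 * 1) \<partial>lborel)"
    using integrable_std_normal_moment[of 2] by (intro nn_integral_eq_integral) auto
  also have "\<dots> = 1" by (subst integral_std_normal_moment_even) simp
  finally show ?thesis .
qed

text \<open>Each squared coordinate has mean 1, so Markov's inequality applies to a sum of mean
  \<open>card J\<close>. The index set is general because the bound is used both for all coordinates
  and for all but one.\<close>

lemma measure_gauss_norm_le:
  fixes J :: "nat set" and K :: real
  assumes J: "finite J" and K: "K > 0"
  defines "M \<equiv> \<Pi>\<^sub>M j\<in>J. std_normal"
  shows "measure M {x \<in> space M. (\<Sum>j\<in>J. (x j)\<^sup>2) \<le> K * real (card J)} \<ge> 1 - 1 / K"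
proof (cases "J = {}")
  \<comment> \<open>Without coordinates the threshold is zero and has no reciprocal, but the event
    is the whole space.\<close>
  case True
  interpret prob_space M unfolding M_def by (intro prob_space_PiM prob_space_std_normal)
  show ?thesis using True K prob_space by simp
next
  case False
  interpret prob_space M unfolding M_def by (intro prob_space_PiM prob_space_std_normal)
  have n: "card J > 0" using J False by (simp add: card_gt_0_iff)
  have comp[measurable]: "(\<lambda>x. x j) \<in> borel_measurable M" if "j \<in> J" for j
    using measurable_component_singleton[OF that, of "\<lambda>_. std_normal"] by (simp add: M_def)
  have sq: "(\<lambda>x. \<Sum>j\<in>J. (x j)\<^sup>2) \<in> borel_measurable M"
    by (intro borel_measurable_sum borel_measurable_power comp)
  note [measurable] = sq
  \<comment> \<open>The reciprocal of the threshold, which normalizes the exceptional event for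
    Markov's inequality.\<close>
  let ?c = "ennreal (1 / (K * real (card J)))"
  have "(\<integral>\<^sup>+x. ennreal (\<Sum>j\<in>J. (x j)\<^sup>2) \<partial>M) = (\<integral>\<^sup>+x. (\<Sum>j\<in>J. ennreal ((x j)\<^sup>2)) \<partial>M)"
    by simp
  also have "\<dots> = (\<Sum>j\<in>J. \<integral>\<^sup>+x. ennreal ((x j)\<^sup>2) \<partial>M)"
    by (intro nn_integral_sum measurable_compose[OF comp]) auto
  also have "\<dots> = (\<Sum>j\<in>J. 1)"
  proof (rule sum.cong[OF refl])
    fix j assume j: "j \<in> J"
    have "(\<integral>\<^sup>+t. ennreal (t\<^sup>2) \<partial>distr M std_normal (\<lambda>x. x j)) = (\<integral>\<^sup>+x. ennreal ((x j)\<^sup>2) \<partial>M)"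
      using comp[OF j] by (intro nn_integral_distr) (auto cong: measurable_cong_sets)
    moreover have "distr M std_normal (\<lambda>x. x j) = std_normal"
      unfolding M_def by (rule distr_PiM_component[OF prob_space_std_normal j])
    ultimately show "(\<integral>\<^sup>+x. ennreal ((x j)\<^sup>2) \<partial>M) = 1"
      by (simp add: nn_integral_std_normal_square)
  qed
  finally have int: "(\<integral>\<^sup>+x. ennreal (\<Sum>j\<in>J. (x j)\<^sup>2) \<partial>M) = ennreal (card J)"
    by (simp add: ennreal_of_nat_eq_real_of_nat)
  let ?B = "{x \<in> space M. (\<Sum>j\<in>J. (x j)\<^sup>2) \<le> K * real (card J)}"
  have B: "?B \<in> events" by measurable
  have "emeasure M (space M - ?B)
      \<le> emeasure M {x \<in> space M. 1 \<le> ?c * ennreal (\<Sum>j\<in>J. (x j)\<^sup>2)}"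
  proof (rule emeasure_mono)
    show "space M - ?B \<subseteq> {x \<in> space M. 1 \<le> ?c * ennreal (\<Sum>j\<in>J. (x j)\<^sup>2)}"
    proof
      fix x assume "x \<in> space M - ?B"
      then have x: "x \<in> space M" "K * real (card J) < (\<Sum>j\<in>J. (x j)\<^sup>2)" by auto
      then have "1 \<le> 1 / (K * real (card J)) * (\<Sum>j\<in>J. (x j)\<^sup>2)"
        using K n by (simp add: field_simps)
      then have "ennreal 1 \<le> ennreal (1 / (K * real (card J)) * (\<Sum>j\<in>J. (x j)\<^sup>2))"
        by (rule ennreal_leI)
      also have "\<dots> = ?c * ennreal (\<Sum>j\<in>J. (x j)\<^sup>2)"
        using K by (intro ennreal_mult) (auto simp: sum_nonneg)
      finally show "x \<in> {x \<in> space M. 1 \<le> ?c * ennreal (\<Sum>j\<in>J. (x j)\<^sup>2)}"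
        using x by simp
    qed
  qed measurable
  also have "\<dots> \<le> ?c * (\<integral>\<^sup>+x. ennreal (\<Sum>j\<in>J. (x j)\<^sup>2) * indicator (space M) x \<partial>M)"
    by (rule nn_integral_Markov_inequality) measurable
  also have "\<dots> = ?c * ennreal (card J)"
    by (simp only: int[symmetric]) (auto intro!: arg_cong2[where f="(*)"] nn_integral_cong)
  also have "\<dots> = ennreal (1 / K)"
    using K n by (simp flip: ennreal_mult)
  finally have "prob (space M - ?B) \<le> 1 / K"
    using K by (simp add: emeasure_eq_measure)
  then show ?thesis using prob_compl[OF B] by simp
qed

text \<open>The density is positive everywhere, so a set that is null for it is null for Lebesgue
  measure.\<close>

lemma std_normal_tail_pos: "measure std_normal {L<..} > 0"
proof (rule ccontr)
  interpret prob_space std_normal by (rule prob_space_std_normal)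
  assume "\<not> measure std_normal {L<..} > 0"
  then have "emeasure std_normal {L<..} = 0"
    using measure_nonneg[of std_normal "{L<..}"] by (simp add: emeasure_eq_measure)
  then have "{L<..} \<in> null_sets std_normal" by (simp add: null_sets_def)
  then have "AE x in lborel. x \<in> {L<..} \<longrightarrow> ennreal (std_normal_density x) = 0"
    by (subst (asm) null_sets_density_iff) auto
  \<comment> \<open>A piece of the tail with Lebesgue measure 1 suffices for the
    contradiction.\<close>
  then have "AE x in lborel. x \<notin> {L<..<L+1}"
  proof eventually_elim
    case (elim x)
    have "std_normal_density x > 0" by (rule normal_density_pos) simp
    with elim show ?case by (auto simp: ennreal_eq_0_iff)
  qed
  then have "AE x in lborel. x \<in> {L<..<L+1} \<longrightarrow> x \<in> {}" by simp
  then have "emeasure lborel {L<..<L+1} \<le> emeasure lborel ({} :: real set)"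
    by (rule emeasure_mono_AE) simp
  then show False by simp
qed

text \<open>By independence the probability factors into the tail of one coordinate and the norm
  event for the other \<open>q - 1\<close>. The latter has probability at least 1/2, by Markov's
  inequality with \<open>K = 2\<close>.\<close>

lemma measure_gauss_coord_and_rest:
  assumes i: "i \<in> {1..q}"
  shows "measure (gauss q) {x \<in> Rvec q. L < x i \<and> (\<Sum>j\<in>{1..q} - {i}. (x j)\<^sup>2) \<le> 2 * (real q - 1)}
    \<ge> measure std_normal {L<..} / 2"
proof -
  interpret N: prob_space std_normal by (rule prob_space_std_normal)
  interpret G: prob_space "gauss q" by (rule prob_space_gauss)
  let ?J = "{1..q} - {i}"
  let ?M = "\<Pi>\<^sub>M j\<in>?J. std_normal"
  interpret M: prob_space ?M by (intro prob_space_PiM prob_space_std_normal)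
  let ?E = "{x \<in> Rvec q. L < x i \<and> (\<Sum>j\<in>?J. (x j)\<^sup>2) \<le> 2 * (real q - 1)}"
  let ?B = "{x \<in> space ?M. (\<Sum>j\<in>?J. (x j)\<^sup>2) \<le> 2 * card ?J}"
  have card: "real (card ?J) = real q - 1" using i by (simp add: of_nat_diff)
  have "{x \<in> space (PB q). L < x i \<and> (\<Sum>j\<in>?J. (x j)\<^sup>2) \<le> 2 * (real q - 1)} \<in> sets (PB q)"
    using i by measurable
  then have E: "?E \<in> sets (PB q)" by (simp only: space_PB)
  have comp: "(\<lambda>x. x j) \<in> borel_measurable ?M" if "j \<in> ?J" for j
    using measurable_component_singleton[OF that, of "\<lambda>_. std_normal"] by simp
  have [measurable]: "(\<lambda>x. \<Sum>j\<in>?J. (x j)\<^sup>2) \<in> borel_measurable ?M"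
    by (intro borel_measurable_sum borel_measurable_power comp)
  have B: "?B \<in> sets ?M" by measurable
  have "emeasure (gauss q) ?E = (\<integral>\<^sup>+x. (\<integral>\<^sup>+y. indicator ?E (x(i := y)) \<partial>std_normal) \<partial>?M)"
    by (rule emeasure_gauss_split[OF i E])
  also have "\<dots> = (\<integral>\<^sup>+x. emeasure std_normal {L<..} * indicator ?B x \<partial>?M)"
  proof (rule nn_integral_cong)
    fix x assume x: "x \<in> space ?M"
    have "x(i := y) \<in> Rvec q" for y
      using x i by (auto simp: space_PiM Rvec_def PiE_def extensional_def)
    moreover have "(\<Sum>j\<in>?J. ((x(i := y)) j)\<^sup>2) = (\<Sum>j\<in>?J. (x j)\<^sup>2)" for y
      by (rule sum.cong) auto
    ultimately have "indicator ?E (x(i := y)) = (indicator ?B x * indicator {L<..} y :: ennreal)" for y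
      using x card by (auto simp: indicator_def)
    then show "(\<integral>\<^sup>+y. indicator ?E (x(i := y)) \<partial>std_normal)
        = emeasure std_normal {L<..} * indicator ?B x"
      by (simp only:) (subst nn_integral_cmult_indicator, simp_all add: mult.commute)
  qed
  also have "\<dots> = emeasure std_normal {L<..} * emeasure ?M ?B"
    using B by (simp add: nn_integral_cmult_indicator)
  finally have "measure (gauss q) ?E = measure std_normal {L<..} * measure ?M ?B"
    by (simp add: G.emeasure_eq_measure N.emeasure_eq_measure M.emeasure_eq_measure
        ennreal_mult[symmetric])
  moreover have "measure ?M ?B \<ge> 1 / 2"
    using measure_gauss_norm_le[of ?J 2] by simp
  ultimately show ?thesis
    using mult_left_mono[of "1/2" "measure ?M ?B" "measure std_normal {L<..}"] by simp
qed

text \<open>The norm event minus the box on which every coordinate is at most \<open>L\<close>. By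
  independence the box has probability equal to the \<open>q\<close>-th power of the one-dimensional
  probability.\<close>

lemma measure_gauss_some_large:
  fixes K :: real
  assumes K: "K > 0"
  shows "measure (gauss q) {x \<in> Rvec q. (\<exists>i\<in>{1..q}. L < x i) \<and> (\<Sum>j\<in>{1..q}. (x j)\<^sup>2) \<le> K * real q}
    \<ge> 1 - 1 / K - measure std_normal {..L} ^ q"
proof -
  interpret G: prob_space "gauss q" by (rule prob_space_gauss)
  interpret N: prob_space std_normal by (rule prob_space_std_normal)
  let ?B = "{x \<in> Rvec q. (\<Sum>j\<in>{1..q}. (x j)\<^sup>2) \<le> K * real q}"
  let ?S = "Pi\<^sub>E {1..q} (\<lambda>_. {..L})"
  have "{x \<in> space (PB q). (\<Sum>j\<in>{1..q}. (x j)\<^sup>2) \<le> K * real q} \<in> sets (PB q)" by measurable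
  then have B: "?B \<in> sets (gauss q)" by (simp only: space_PB sets_gauss)
  have S: "?S \<in> sets (gauss q)" unfolding sets_gauss by (intro sets_PiM_I_finite) auto
  have "emeasure (gauss q) ?S = (\<Prod>i\<in>{1..q}. emeasure std_normal {..L})"
    unfolding gauss_def by (intro std_normal_prod.emeasure_PiM) auto
  then have "ennreal (measure (gauss q) ?S) = ennreal (measure std_normal {..L} ^ q)"
    by (simp add: G.emeasure_eq_measure N.emeasure_eq_measure ennreal_power)
  then have mS: "measure (gauss q) ?S = measure std_normal {..L} ^ q" by simp
  have "1 - 1 / K \<le> measure (gauss q) ?B"
    using measure_gauss_norm_le[of "{1..q}" K] K space_gauss[of q] by (simp add: gauss_def)
  also have "\<dots> \<le> measure (gauss q) (?B - ?S) + measure (gauss q) ?S"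
    using B S by (subst G.finite_measure_Union[symmetric]) (auto intro: G.finite_measure_mono)
  also have "?B - ?S = {x \<in> Rvec q. (\<exists>i\<in>{1..q}. L < x i) \<and> (\<Sum>j\<in>{1..q}. (x j)\<^sup>2) \<le> K * real q}"
    by (auto simp: Rvec_def PiE_def Pi_def not_le)
  finally show ?thesis using mS by simp
qed

section \<open>Caps in the coordinate directions\<close>

text \<open>The variance identity: removing the mean lowers the sum of squares by \<open>q\<close>
  times the squared mean.\<close>

lemma sum_project_squares:
  assumes "q \<ge> 1"
  shows "(L2_set (project q x) {1..q})\<^sup>2 = (\<Sum>i=1..q. (x i)\<^sup>2) - (\<Sum>i=1..q. x i)\<^sup>2 / q"
proof -
  define m where "m = (\<Sum>i=1..q. x i) / q"
  have "(L2_set (project q x) {1..q})\<^sup>2 = (\<Sum>i=1..q. (project q x i)\<^sup>2)"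
    by (simp add: L2_set_def sum_nonneg)
  also have "\<dots> = (\<Sum>i=1..q. (x i - m)\<^sup>2)"
    by (rule sum.cong) (auto simp: project_apply m_def)
  also have "\<dots> = (\<Sum>i=1..q. (x i)\<^sup>2 + m\<^sup>2 - 2 * m * x i)"
    by (simp add: power2_diff mult_ac)
  also have "\<dots> = (\<Sum>i=1..q. (x i)\<^sup>2) + q * m\<^sup>2 - 2 * m * (\<Sum>i=1..q. x i)"
    by (simp add: sum.distrib sum_subtractf sum_distrib_left)
  also have "\<dots> = (\<Sum>i=1..q. (x i)\<^sup>2) - (\<Sum>i=1..q. x i)\<^sup>2 / q"
    using assms by (simp add: m_def field_simps power2_eq_square)
  finally show ?thesis .
qed

definition regular_norm :: "nat \<Rightarrow> real" where
  "regular_norm q = L2_set (regular_y q) {1..q}"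

lemma regular_y_apply: "i \<in> {1..q} \<Longrightarrow> regular_y q i = real i - (real q + 1) / 2"
  by (simp add: regular_y_def regular_x_def ones_def)

lemma regular_y_in_Rvec [simp]: "regular_y q \<in> Rvec q"
  by (simp add: regular_y_def Rvec_def)

lemma sum_regular_x: "(\<Sum>i=1..q. regular_x q i) = real q * (real q + 1) / 2"
proof -
  have "(\<Sum>i=1..q. real i) = real q * (real q + 1) / 2"
    by (induction q) (auto simp: field_simps)
  then show ?thesis by (simp add: regular_x_def)
qed

lemma project_regular_x: "project q (regular_x q) = regular_y q"
proof (rule Rvec_eqI)
  fix i assume i: "i \<in> {1..q}"
  then have "real q \<noteq> 0" by auto
  then show "project q (regular_x q) i = regular_y q i"
    unfolding project_apply[OF i] sum_regular_x regular_y_apply[OF i]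
    using i by (simp add: regular_x_def field_simps)
qed simp_all

text \<open>The variance identity applied to the numbers from 1 to \<open>q\<close>.\<close>

lemma regular_norm_square:
  assumes "q \<ge> 1"
  shows "(regular_norm q)\<^sup>2 = real q * (real q - 1) * (real q + 1) / 12"
proof -
  have "(\<Sum>i=1..q. (real i)\<^sup>2) = real q * (real q + 1) * (2 * real q + 1) / 6"
    by (induction q) (auto simp: field_simps power2_eq_square)
  then have sq: "(\<Sum>i=1..q. (regular_x q i)\<^sup>2) = real q * (real q + 1) * (2 * real q + 1) / 6"
    by (simp add: regular_x_def)
  then show ?thesis
    unfolding regular_norm_def project_regular_x[symmetric] sum_project_squares[OF assms]
      sum_regular_x sq
    using assms by (simp add: field_simps power2_eq_square)
qed

lemma regular_norm_pos: "q \<ge> 2 \<Longrightarrow> regular_norm q > 0"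
proof -
  assume q: "q \<ge> 2"
  then have "(regular_norm q)\<^sup>2 > 0" by (subst regular_norm_square) auto
  moreover have "regular_norm q \<ge> 0" by (simp add: regular_norm_def)
  ultimately show ?thesis by (cases "regular_norm q = 0") auto
qed

lemma regular_y_in_hsphere: "regular_y q \<in> hsphere q (regular_norm q)"
  using project_in_hyperplane[of q "regular_x q"]
  by (simp add: hsphere_def project_regular_x regular_norm_def)

text \<open>The level is the largest coordinate of \<open>regular_y q\<close>; the strict inequality
  keeps every permutation of that vector outside.\<close>

definition coord_cap :: "nat \<Rightarrow> nat \<Rightarrow> (nat \<Rightarrow> real) set" where
  "coord_cap q i = {v \<in> hsphere q (regular_norm q). v i > (real q - 1) / 2}"

lemma coord_cap_sub: "coord_cap q i \<subseteq> hsphere q (regular_norm q)"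
  by (auto simp: coord_cap_def)

lemma sets_coord_cap: "i \<in> {1..q} \<Longrightarrow> coord_cap q i \<in> sets (PB q)"
proof -
  assume i: "i \<in> {1..q}"
  then have "hsphere q (regular_norm q) \<inter> {v \<in> space (PB q). v i > (real q - 1) / 2} \<in> sets (PB q)"
    by measurable
  also have "hsphere q (regular_norm q) \<inter> {v \<in> space (PB q). v i > (real q - 1) / 2} = coord_cap q i"
    using hsphere_sub_Rvec by (auto simp: coord_cap_def space_PB)
  finally show ?thesis .
qed

lemma coord_cap_avoids_orbit:
  assumes i: "i \<in> {1..q}"
  shows "coord_cap q i \<inter> perm_orbit q (regular_y q) = {}"
proof -
  have "v i \<le> (real q - 1) / 2" if v: "v \<in> perm_orbit q (regular_y q)" for v
  proof -
    obtain P \<sigma> where v: "v = mat_vec q P (regular_y q)" and \<sigma>: "\<sigma> permutes {1..q}"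
      and P: "\<forall>i\<in>{1..q}. \<forall>j\<in>{1..q}. P i j = (if j = \<sigma> i then 1 else 0)"
      using v by (auto simp: perm_orbit_def permutation_mat_def)
    have \<sigma>i: "\<sigma> i \<in> {1..q}" using permutes_in_image[OF \<sigma>] i by blast
    have "v i = (\<Sum>j=1..q. if j = \<sigma> i then regular_y q j else 0)"
      unfolding v mat_vec_apply[OF i] by (rule sum.cong) (use P i in auto)
    also have "\<dots> = regular_y q (\<sigma> i)" using \<sigma>i by simp
    finally show ?thesis using \<sigma>i by (simp add: regular_y_apply field_simps)
  qed
  then show ?thesis by (force simp: coord_cap_def)
qed

text \<open>The centre of the cap is the normalized projection of the \<open>i\<close>-th unit vector.\<close>

lemma is_cap_coord_cap:
  assumes q: "q \<ge> 3" and i: "i \<in> {1..q}"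
  shows "is_cap q (regular_norm q) (coord_cap q i)"
proof -
  define \<rho> where "\<rho> = regular_norm q"
  define e :: "nat \<Rightarrow> real" where "e j = (if j = i then 1 else 0)" for j
  define s where "s = L2_set (project q e) {1..q}"
  define w where "w = to_sphere q \<rho> (regular_y q) e"
  \<comment> \<open>On the sphere \<open>v . w\<close> equals \<open>\<rho> / s\<close> times
    coordinate \<open>i\<close> of \<open>v\<close>, so this level corresponds to the coordinate
    threshold \<open>(q - 1) / 2\<close>.\<close>
  define t where "t = (real q - 1) / (2 * \<rho> * s)"
  have \<rho>: "\<rho> > 0" and \<rho>2: "12 * \<rho>\<^sup>2 = real q * (real q - 1) * (real q + 1)"
    using regular_norm_pos[of q] regular_norm_square[of q] q by (auto simp: \<rho>_def)
  have se: "(\<Sum>j=1..q. e j) = 1" "(\<Sum>j=1..q. (e j)\<^sup>2) = 1"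
    using i by (simp_all add: e_def if_distrib[of "\<lambda>t. t\<^sup>2"] cong: if_cong)
  have s2: "s\<^sup>2 = 1 - 1 / q" using sum_project_squares[of q e] q by (simp add: s_def se)
  have s: "s > 0"
  proof -
    have "s\<^sup>2 > 0" using q by (simp add: s2)
    moreover have "s \<ge> 0" by (simp add: s_def)
    ultimately show ?thesis by (cases "s = 0") auto
  qed
  have w: "w \<in> hsphere q \<rho>"
    using to_sphere_in_hsphere[OF regular_y_in_hsphere] \<rho> by (simp add: w_def \<rho>_def)
  \<comment> \<open>This is the squared form of \<open>t < 1\<close>. It reduces to
    \<open>q + 1 > 3\<close>.\<close>
  have "(real q - 1)\<^sup>2 < (2 * \<rho> * s)\<^sup>2"
  proof -
    have "3 * (2 * \<rho> * s)\<^sup>2 = (12 * \<rho>\<^sup>2) * s\<^sup>2" by (simp add: power_mult_distrib)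
    also have "\<dots> = (real q - 1)\<^sup>2 * (real q + 1)"
      using q unfolding \<rho>2 s2 by (simp add: field_simps power2_eq_square)
    finally have "3 * (2 * \<rho> * s)\<^sup>2 = (real q - 1)\<^sup>2 * (real q + 1)" .
    moreover have "(real q - 1)\<^sup>2 * (real q + 1) > (real q - 1)\<^sup>2 * 3"
      using q by (intro mult_strict_left_mono) auto
    ultimately show ?thesis by simp
  qed
  then have "real q - 1 < 2 * \<rho> * s" by (rule power2_less_imp_less) (use \<rho> s in auto)
  then have t1: "t < 1" using \<rho> s by (simp add: t_def)
  have t0: "-1 \<le> t" using \<rho> s q by (intro order_trans[of "-1" 0 t]) (auto simp: t_def)
  have dot: "dotp q v w = \<rho> / s * v i" if v: "v \<in> hsphere q \<rho>" for v
  proof -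
    have "dotp q v w = (\<Sum>j=1..q. \<rho> / s * (if j = i then v j else 0) - \<rho> / s / q * v j)"
      unfolding dotp_def
    proof (rule sum.cong[OF refl])
      fix j assume j: "j \<in> {1..q}"
      have wj: "w j = \<rho> / s * (e j - 1 / q)"
        using s j by (simp add: w_def to_sphere_def project_apply se flip: s_def)
      show "v j * w j = \<rho> / s * (if j = i then v j else 0) - \<rho> / s / q * v j"
        unfolding wj e_def by (cases "j = i") (simp_all add: algebra_simps)
    qed
    also have "\<dots> = \<rho> / s * (\<Sum>j=1..q. if j = i then v j else 0) - \<rho> / s / q * (\<Sum>j=1..q. v j)"
      by (simp only: sum_subtractf sum_distrib_left)
    also have "\<dots> = \<rho> / s * v i"
      using v i by (simp add: hsphere_def hyperplane_eq)
    finally show ?thesis .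
  qed
  have "\<rho>\<^sup>2 * t = \<rho> / s * ((real q - 1) / 2)"
    using \<rho> s by (simp add: t_def power2_eq_square)
  then have "dotp q v w > \<rho>\<^sup>2 * t \<longleftrightarrow> v i > (real q - 1) / 2" if "v \<in> hsphere q \<rho>" for v
    using dot[OF that] \<rho> s by (simp only: mult_less_cancel_left_pos[of "\<rho> / s"] divide_pos_pos)
  then have "coord_cap q i = cap q \<rho> w t"
    by (auto simp: coord_cap_def cap_def \<rho>_def)
  then show ?thesis
    unfolding is_cap_def \<rho>_def[symmetric] using w t0 t1 by blast
qed

section \<open>Gaussian vectors that are mapped into a cap\<close>

text \<open>Membership means that the projected coordinate, scaled by radius over norm, exceeds
  \<open>(q - 1) / 2\<close>. Squaring, inserting the value of the squared radius and cancelling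
  \<open>q - 1\<close> gives the polynomial hypothesis.\<close>

lemma to_sphere_in_coord_cap:
  assumes q: "q \<ge> 3" and i: "i \<in> {1..q}" and pos: "project q x i > 0"
    and le: "3 * (real q - 1) * (L2_set (project q x) {1..q})\<^sup>2
      < real q * (real q + 1) * (project q x i)\<^sup>2"
  shows "to_sphere q (regular_norm q) (regular_y q) x \<in> coord_cap q i"
proof -
  let ?N = "L2_set (project q x) {1..q}" and ?P = "project q x i" and ?\<rho> = "regular_norm q"
  have \<rho>: "?\<rho> > 0" and \<rho>2: "12 * ?\<rho>\<^sup>2 = real q * (real q - 1) * (real q + 1)"
    using regular_norm_pos[of q] regular_norm_square[of q] q by auto
  have N: "?N > 0"
  proof -
    have "?N \<noteq> 0"
    proof
      assume "?N = 0"
      then have "?P = 0" using i by (simp add: L2_set_eq_0_iff)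
      with pos show False by simp
    qed
    then show ?thesis using L2_set_nonneg[of "project q x" "{1..q}"] by linarith
  qed
  have "((real q - 1) * ?N)\<^sup>2 * 3 = (real q - 1) * (3 * (real q - 1) * ?N\<^sup>2)"
    by (simp add: power2_eq_square)
  also have "\<dots> < (real q - 1) * (real q * (real q + 1) * ?P\<^sup>2)"
    using q le by (intro mult_strict_left_mono) auto
  also have "\<dots> = (12 * ?\<rho>\<^sup>2) * ?P\<^sup>2" unfolding \<rho>2 by simp
  also have "\<dots> = (2 * ?\<rho> * ?P)\<^sup>2 * 3" by (simp add: power_mult_distrib)
  finally have "((real q - 1) * ?N)\<^sup>2 < (2 * ?\<rho> * ?P)\<^sup>2" by simp
  then have "(real q - 1) * ?N < 2 * ?\<rho> * ?P"
    by (rule power2_less_imp_less) (use pos \<rho> in auto)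
  then have "(real q - 1) / 2 < ?\<rho> / ?N * ?P" using N by (simp add: field_simps)
  then show ?thesis
    using to_sphere_in_hsphere[OF regular_y_in_hsphere, of q x] \<rho> N i
    by (auto simp: coord_cap_def to_sphere_def)
qed

text \<open>Coordinate \<open>i\<close> may be arbitrarily large, so the norm is split: with
  \<open>m\<close> the mean of the other coordinates and \<open>d = x i - m\<close>, the projected
  coordinate is \<open>c * d\<close> and the squared norm is \<open>c * d\<^sup>2\<close> plus the
  spread \<open>R - n * m\<^sup>2\<close> of the others.\<close>

lemma coord_gt_6_in_cap:
  assumes q: "q \<ge> 3" and i: "i \<in> {1..q}" and xi: "6 < x i"
    and rest: "(\<Sum>j\<in>{1..q} - {i}. (x j)\<^sup>2) \<le> 2 * (real q - 1)"
  shows "to_sphere q (regular_norm q) (regular_y q) x \<in> coord_cap q i"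
proof (rule to_sphere_in_coord_cap[OF q i])
  define R where "R = (\<Sum>j\<in>{1..q} - {i}. (x j)\<^sup>2)"
  define n where "n = real q - 1"
  define m where "m = (\<Sum>j\<in>{1..q} - {i}. x j) / n"
  define d where "d = x i - m"
  define c where "c = n / (n + 1)"
  have n: "n \<ge> 2" using q by (simp add: n_def)
  have qn: "real q = n + 1" by (simp add: n_def)
  have sum: "(\<Sum>j=1..q. x j) = x i + n * m" and sq: "(\<Sum>j=1..q. (x j)\<^sup>2) = (x i)\<^sup>2 + R"
    using i n by (simp_all add: R_def m_def sum.remove[of _ i])
  \<comment> \<open>Cauchy-Schwarz for the \<open>n\<close> other coordinates. It leads to
    \<open>m < 3/2\<close>, whence \<open>d > 6 - 3/2 = 9/2\<close>.\<close>
  have "(n * m)\<^sup>2 \<le> R * n"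
    using sum_squared_le_sum_of_squares[of x "{1..q} - {i}"] i n
    by (simp add: R_def m_def n_def of_nat_diff)
  then have "n * (n * m\<^sup>2) \<le> n * R" by (simp add: power2_eq_square mult_ac)
  then have nm: "n * m\<^sup>2 \<le> R" using n by simp
  have "n * m\<^sup>2 \<le> n * 2" using nm rest by (simp add: R_def n_def)
  then have "m\<^sup>2 \<le> 2" using n by simp
  then have "m \<le> sqrt 2" by (simp add: real_le_rsqrt)
  moreover have "sqrt 2 < 3/2" by (rule real_less_lsqrt) (auto simp: power2_eq_square)
  ultimately have d: "d > 9/2" using xi by (simp add: d_def)
  have c: "c > 0" "(n + 1) * c = n" using n by (simp_all add: c_def)
  have P: "project q x i = c * d"
    unfolding project_apply[OF i] sum qn d_def c_def using n by (simp add: field_simps)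
  then show "project q x i > 0" using c d by simp
  have "d\<^sup>2 > 18" using power_strict_mono[of "9/2" d 2] d by (simp add: power2_eq_square)
  have N: "(L2_set (project q x) {1..q})\<^sup>2 = c * d\<^sup>2 + (R - n * m\<^sup>2)"
    using sum_project_squares[of q x] q n unfolding sum sq qn d_def c_def
    by (simp add: field_simps power2_eq_square)
  have "3 * n * (R - n * m\<^sup>2) < n * (n - 1) * c * d\<^sup>2"
  proof -
    have "3 * n * (R - n * m\<^sup>2) \<le> 3 * n * (2 * n)"
      using n rest by (intro mult_left_mono) (auto simp: R_def n_def intro: order_trans[of _ R])
    \<comment> \<open>The factor 1/3 is the least value of \<open>(n - 1) / (n + 1)\<close> for
      \<open>n \<ge> 2\<close>, attained at \<open>q = 3\<close>; the remaining 18 lies below the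
      square of 9/2.\<close>
    also have "\<dots> = n\<^sup>2 * (1/3) * 18" by (simp add: power2_eq_square)
    also have "\<dots> < n\<^sup>2 * (1/3) * d\<^sup>2"
      using n \<open>d\<^sup>2 > 18\<close> by (intro mult_strict_left_mono) auto
    also have "\<dots> \<le> n\<^sup>2 * ((n - 1) / (n + 1)) * d\<^sup>2"
      using n by (intro mult_right_mono mult_left_mono) (auto simp: field_simps)
    finally show ?thesis by (simp add: c_def power2_eq_square mult_ac)
  qed
  \<comment> \<open>The terms in \<open>d\<^sup>2\<close> on both sides are combined by
    \<open>(n + 1) * c = n\<close>; the remainder dominates the spread.\<close>
  moreover have "real q * (real q + 1) * (project q x i)\<^sup>2 - 3 * n * (c * d\<^sup>2) = n * (n - 1) * c * d\<^sup>2"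
  proof -
    have "real q * (real q + 1) * (project q x i)\<^sup>2 = ((n + 1) * c) * (n + 2) * c * d\<^sup>2"
      unfolding P qn by (simp add: power_mult_distrib power2_eq_square)
    then show ?thesis unfolding c(2) by (simp add: algebra_simps)
  qed
  ultimately show "3 * (real q - 1) * (L2_set (project q x) {1..q})\<^sup>2
      < real q * (real q + 1) * (project q x i)\<^sup>2"
    unfolding N n_def[symmetric] by (simp add: distrib_left)
qed

text \<open>By Cauchy-Schwarz the mean is at most \<open>sqrt K\<close>, so of the
  \<open>3 * sqrt K\<close> more than \<open>2 * sqrt K\<close> survives the projection. The squared
  coordinate then exceeds \<open>4 * K\<close>, against a squared norm of at most
  \<open>K * q\<close>.\<close>

lemma large_coord_in_cap:
  assumes q: "q \<ge> 3" and i: "i \<in> {1..q}" and K: "K > 0" and xi: "3 * sqrt K < x i"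
    and norm: "(\<Sum>j\<in>{1..q}. (x j)\<^sup>2) \<le> K * real q"
  shows "to_sphere q (regular_norm q) (regular_y q) x \<in> coord_cap q i"
proof (rule to_sphere_in_coord_cap[OF q i])
  define m where "m = (\<Sum>j=1..q. x j) / real q"
  have q0: "real q > 0" using q by simp
  have "(real q * m)\<^sup>2 \<le> (K * real q) * real q"
    using sum_squared_le_sum_of_squares[of x "{1..q}"] norm q0
    by (auto simp: m_def intro: order_trans mult_right_mono)
  then have "m\<^sup>2 \<le> K" using q0 by (simp add: power2_eq_square)
  then have "m \<le> sqrt K" by (simp add: real_le_rsqrt)
  then have P: "2 * sqrt K < project q x i" using xi by (simp add: project_apply[OF i] m_def)
  then show "project q x i > 0" using K by (smt (verit) real_sqrt_gt_zero)
  have "(2 * sqrt K)\<^sup>2 < (project q x i)\<^sup>2"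
    using P K by (intro power_strict_mono) auto
  then have P2: "4 * K < (project q x i)\<^sup>2" using K by (simp add: power_mult_distrib)
  have "(L2_set (project q x) {1..q})\<^sup>2 \<le> K * real q"
  proof -
    have "0 \<le> (\<Sum>i=1..q. x i)\<^sup>2 / real q" by simp
    then show ?thesis using sum_project_squares[of q x] norm q by linarith
  qed
  then have "3 * (real q - 1) * (L2_set (project q x) {1..q})\<^sup>2 \<le> 3 * (real q - 1) * (K * real q)"
    using q by (intro mult_left_mono) auto
  also have "\<dots> \<le> real q * (real q + 1) * (4 * K)"
    using q K by (simp add: field_simps)
  also have "\<dots> < real q * (real q + 1) * (project q x i)\<^sup>2"
    using q0 P2 by (intro mult_strict_left_mono) auto
  finally show "3 * (real q - 1) * (L2_set (project q x) {1..q})\<^sup>2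
      < real q * (real q + 1) * (project q x i)\<^sup>2" .
qed

section \<open>Measures of the caps and of their union\<close>

lemma measure_coord_cap_ge:
  assumes q: "q \<ge> 3" and i: "i \<in> {1..q}"
  shows "measure (uniform_hsphere q (regular_norm q)) (coord_cap q i) \<ge> measure std_normal {6<..} / 2"
proof -
  interpret prob_space "gauss q" by (rule prob_space_gauss)
  have "q \<ge> 2" "regular_norm q \<ge> 0" using q by (auto simp: regular_norm_def)
  note U = measure_uniform_hsphere[OF this(1) regular_y_in_hsphere this(2)
      sets_coord_cap[OF i] coord_cap_sub]
  have "measure std_normal {6<..} / 2
      \<le> prob {x \<in> Rvec q. 6 < x i \<and> (\<Sum>j\<in>{1..q} - {i}. (x j)\<^sup>2) \<le> 2 * (real q - 1)}"
    by (rule measure_gauss_coord_and_rest[OF i])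
  also have "\<dots> \<le> prob {x \<in> Rvec q. to_sphere q (regular_norm q) (regular_y q) x \<in> coord_cap q i}"
    using coord_gt_6_in_cap[OF q i] by (intro finite_measure_mono U(2)) auto
  finally show ?thesis by (simp only: U(1))
qed

lemma measure_coord_caps_ge:
  assumes q: "q \<ge> 3" and K: "K > 0"
  shows "measure (uniform_hsphere q (regular_norm q)) (\<Union>i\<in>{1..q}. coord_cap q i)
    \<ge> 1 - 1 / K - measure std_normal {..3 * sqrt K} ^ q"
proof -
  interpret prob_space "gauss q" by (rule prob_space_gauss)
  have "q \<ge> 2" "regular_norm q \<ge> 0" using q by (auto simp: regular_norm_def)
  moreover have "(\<Union>i\<in>{1..q}. coord_cap q i) \<in> sets (PB q)"
    using sets_coord_cap by (intro sets.finite_UN) auto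
  moreover have "(\<Union>i\<in>{1..q}. coord_cap q i) \<subseteq> hsphere q (regular_norm q)"
    using coord_cap_sub by blast
  ultimately have U: "measure (uniform_hsphere q (regular_norm q)) (\<Union>i\<in>{1..q}. coord_cap q i)
      = prob {x \<in> Rvec q. to_sphere q (regular_norm q) (regular_y q) x \<in> (\<Union>i\<in>{1..q}. coord_cap q i)}"
    and S: "{x \<in> Rvec q. to_sphere q (regular_norm q) (regular_y q) x \<in> (\<Union>i\<in>{1..q}. coord_cap q i)}
      \<in> events"
    using measure_uniform_hsphere[OF _ regular_y_in_hsphere] by blast+
  have "1 - 1 / K - measure std_normal {..3 * sqrt K} ^ q
      \<le> prob {x \<in> Rvec q. (\<exists>i\<in>{1..q}. 3 * sqrt K < x i) \<and> (\<Sum>j\<in>{1..q}. (x j)\<^sup>2) \<le> K * real q}"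
    by (rule measure_gauss_some_large[OF K])
  also have "\<dots> \<le> prob {x \<in> Rvec q.
      to_sphere q (regular_norm q) (regular_y q) x \<in> (\<Union>i\<in>{1..q}. coord_cap q i)}"
    using large_coord_in_cap[OF q _ K] by (intro finite_measure_mono S) blast
  finally show ?thesis by (simp only: U)
qed

lemma coord_caps_tendsto:
  "(\<lambda>q. measure (uniform_hsphere q (regular_norm q)) (\<Union>i\<in>{1..q}. coord_cap q i)) \<longlonglongrightarrow> 1"
  (is "?f \<longlonglongrightarrow> 1")
proof (rule order_tendstoI)
  fix a :: real assume a: "a < 1"
  \<comment> \<open>Half of the gap \<open>1 - a\<close> is spent on \<open>1 / K\<close>, the other
    half on the power of \<open>?p\<close>, which vanishes as \<open>q\<close> grows with
    \<open>K\<close> fixed.\<close>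
  define K where "K = 2 / (1 - a)"
  have K: "K > 0" "1 - 1 / K = (1 + a) / 2" using a by (auto simp: K_def field_simps)
  interpret N: prob_space std_normal by (rule prob_space_std_normal)
  let ?p = "N.prob {..3 * sqrt K}"
  have "?p = 1 - N.prob {3 * sqrt K<..}"
    using N.prob_compl[of "{3 * sqrt K<..}"] by (simp add: Compl_eq_Diff_UNIV[symmetric] not_less)
  then have "?p < 1" using std_normal_tail_pos[of "3 * sqrt K"] by simp
  then have "(\<lambda>q. ?p ^ q) \<longlonglongrightarrow> 0" by (intro LIMSEQ_realpow_zero) auto
  then have "eventually (\<lambda>q. ?p ^ q < (1 - a) / 2) sequentially"
    using a by (intro order_tendstoD(2)) auto
  with eventually_ge_at_top[of 3] show "eventually (\<lambda>q. a < ?f q) sequentially"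
  proof eventually_elim
    case (elim q)
    have "a = 1 - 1 / K - (1 - a) / 2" using K(2) by (simp add: field_simps)
    also have "\<dots> < 1 - 1 / K - ?p ^ q" using elim by simp
    also have "\<dots> \<le> ?f q" by (rule measure_coord_caps_ge[OF elim(1) K(1)])
    finally show ?case .
  qed
next
  fix a :: real assume a: "1 < a"
  show "eventually (\<lambda>q. ?f q < a) sequentially"
    using eventually_ge_at_top[of 3]
  proof eventually_elim
    case (elim q)
    have q: "q \<ge> 2" "regular_norm q \<ge> 0" using elim by (auto simp: regular_norm_def)
    have "to_sphere q (regular_norm q) (regular_y q) \<in> gauss q \<rightarrow>\<^sub>M
        restrict_space (PB q) (hsphere q (regular_norm q))"
      using measurable_to_sphere[OF regular_y_in_hsphere q(2)]
      by (simp add: measurable_cong_sets[OF sets_gauss refl])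
    then have "prob_space (uniform_hsphere q (regular_norm q))"
      unfolding uniform_hsphere_eq[OF q(1) regular_y_in_hsphere q(2)]
      by (rule prob_space.prob_space_distr[OF prob_space_gauss])
    then show ?case using a prob_space.prob_le_1 by (meson order_le_less_trans)
  qed
qed

section \<open>The regular configurations are asymptotically permutation-empty\<close>

lemma regular_y_in_ordered_hyperplane: "regular_y q \<in> ordered_hyperplane q"
proof -
  have "mono_on {1..q} (regular_y q)"
    by (rule mono_onI) (simp add: regular_y_apply)
  then show ?thesis
    using regular_y_in_hsphere[of q] by (simp add: ordered_hyperplane_def hsphere_def)
qed

lemma centered_APE_regular_y: "centered_APE regular_y"
  unfolding centered_APE_def regular_norm_def[symmetric]
proof (intro conjI allI impI regular_y_in_ordered_hyperplane)
  fix q :: nat assume q: "q \<ge> 3"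
  have "regular_y q 1 \<noteq> (\<lambda>i\<in>{1..q}. 0) 1" using q by (simp add: regular_y_apply)
  then show "regular_y q \<noteq> (\<lambda>i\<in>{1..q}. 0)" by metis
next
  \<comment> \<open>A Gaussian tail that does not involve \<open>q\<close>; the factor 1/2 is the
    probability retained for the norm of the other coordinates.\<close>
  let ?\<epsilon> = "measure std_normal {6<..} / 2"
  have caps: "1 \<le> q \<and> (\<forall>i\<in>{1..q}. is_cap q (regular_norm q) (coord_cap q i) \<and>
      coord_cap q i \<subseteq> hsphere q (regular_norm q) - perm_orbit q (regular_y q) \<and>
      ?\<epsilon> \<le> measure (uniform_hsphere q (regular_norm q)) (coord_cap q i))" if "q \<ge> 3" for q
    using that is_cap_coord_cap measure_coord_cap_ge coord_cap_sub coord_cap_avoids_orbit by fastforce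
  have "?\<epsilon> > 0" using std_normal_tail_pos[of 6] by simp
  then show "\<exists>\<epsilon>>0. \<exists>(n :: nat \<Rightarrow> nat) C. (\<forall>q\<ge>3. 1 \<le> n q \<and>
      (\<forall>i\<in>{1..n q}. is_cap q (regular_norm q) (C q i) \<and>
        C q i \<subseteq> hsphere q (regular_norm q) - perm_orbit q (regular_y q) \<and>
        \<epsilon> \<le> measure (uniform_hsphere q (regular_norm q)) (C q i))) \<and>
      (\<lambda>q. measure (uniform_hsphere q (regular_norm q)) (\<Union>i\<in>{1..n q}. C q i)) \<longlonglongrightarrow> 1"
    by (intro exI[of _ ?\<epsilon>] exI[of _ "\<lambda>q. q"] exI[of _ coord_cap] conjI allI impI
        caps[THEN conjunct1] caps[THEN conjunct2] coord_caps_tendsto)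
qed

theorem proposition3p2:
  shows "APE regular_x \<and> centered_APE regular_y"
proof
  have "regular_x q \<in> Rvec q \<and> mono_on {1..q} (regular_x q) \<and>
      (\<exists>i\<in>{1..q}. \<exists>j\<in>{1..q}. regular_x q i \<noteq> regular_x q j)" if q: "q \<ge> 3" for q
  proof (intro conjI)
    show "mono_on {1..q} (regular_x q)" by (rule mono_onI) (simp add: regular_x_def)
    show "\<exists>i\<in>{1..q}. \<exists>j\<in>{1..q}. regular_x q i \<noteq> regular_x q j"
      using q by (intro bexI[of _ 1] bexI[of _ 2]) (auto simp: regular_x_def)
  qed (simp add: regular_x_def Rvec_def)
  then show "APE regular_x"
    unfolding APE_def project_regular_x using centered_APE_regular_y by blast
qed (rule centered_APE_regular_y)

end
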